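(* Let $q=p^e$ be an odd prime power, and let $\pi_{\mathsf{odd}}$ be the parallelism on $\mathfrak S$ defined as follows: with $T=\left\{\begin{pmatrix}1&x\\0&1\end{pmatrix} : x\in\mathbb F_q\right\}$, $\Omega=\{g\in\mathrm{SL}(2,q) : \text{the lower-left entry } (0,1)g(1,0)^{\mathsf T} \text{ of } g \text{ is a square in } \mathbb F_q \text{ (including } 0)\}$, $\Omega^{\mathsf c}=\mathrm{SL}(2,q)\smallsetminus\Omega$, $A=\{Tg : g\in\Omega\}\cup\{gT : g\in\Omega^{\mathsf c}\}$, put $\pi_{\mathsf{odd}}=\{\{h^{-1}Xh : X\in A\} : h\in\mathrm{SL}(2,q)\}$. Let $c=\begin{pmatrix}1&0\\0&-1\end{pmatrix}$. Then the stabilizer of $\pi_{\mathsf{odd}}$ in the group $\mathfrak A\ltimes R$ equals (a) $\mathrm{P\Sigma L}(2,q)\times\langle\rho_{-\mathbb 1}\rangle$ if $q\equiv 1\pmod 4$, and (b) $\mathrm{P\Sigma L}(2,q)\rtimes\langle\gamma_c\rho_{-\mathbb 1}\rangle$ if $q\equiv 3\pmod 4$.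
   Context: $\mathfrak P$ is the set of Sylow $p$-subgroups of $\mathrm{SL}(2,q)$, $\mathfrak S$ the set of right cosets of members of $\mathfrak P$; a parallelism on $\mathfrak S$ is a partition of $\mathfrak S$ into $q+1$ sets of $q^2-1$ pairwise disjoint cosets. Permutations of $\mathrm{SL}(2,q)$ act on the right and are composed left to right ($\alpha\beta$ means first $\alpha$, then $\beta$); they act on subsets elementwise, on sets of subsets memberwise, and hence on parallelisms; the stabilizer of a parallelism $\pi$ consists of those permutations $\sigma$ with $\pi\cdot\sigma=\pi$. $\mathfrak A$ is the group of permutations of $\mathrm{SL}(2,q)$ given by the group automorphisms of $\mathrm{SL}(2,q)$; $R=\{\rho_h : h\in\mathrm{SL}(2,q)\}$ with $\rho_h\colon g\mapsto gh$; $\mathfrak A\ltimes R$ is the group they generate. For $a\in\mathrm{GL}(2,q)$, $\gamma_a\in\mathfrak A$ is $g\mapsto a^{-1}ga$. $\mathbb 1$ is the identity matrix. $\mathrm{P\Sigma L}(2,q)=\mathrm{PSL}(2,q)\rtimes\mathrm{Aut}(\mathbb F_q)$ denotes the subgroup of $\mathfrak A$ generated by all $\gamma_h$, $h\in\mathrm{SL}(2,q)$, and the field automorphisms of $\mathbb F_q$ acting entrywise on matrices. *)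

theory Defs
  imports
    "HOL-Analysis.Analysis"
    "HOL-Algebra.Bij"
    "HOL-Algebra.Generated_Groups"
    "HOL-Algebra.Group_Action"
    "HOL-Library.Disjoint_Sets"
    "HOL-Computational_Algebra.Primes"
begin

text \<open>The finite field with \<open>q\<close> elements is a type \<open>'a\<close> of classes \<open>field\<close> and \<open>finite\<close>
  with \<open>CARD('a) = q\<close>.\<close>

definition SL2 :: "('a::field ^ 2 ^ 2) monoid" where
  "SL2 = \<lparr>carrier = {g. det g = 1}, mult = (**), one = mat 1\<rparr>"

definition sylow_subgroups :: "nat \<Rightarrow> ('g, 'm) monoid_scheme \<Rightarrow> 'g set set" where
  "sylow_subgroups p G = {P. subgroup P G \<and> card P = p ^ multiplicity p (Coset.order G)}"

definition sylow_cosets :: "nat \<Rightarrow> ('g, 'm) monoid_scheme \<Rightarrow> 'g set set" where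
  "sylow_cosets p G = (\<Union>P \<in> sylow_subgroups p G. rcosets\<^bsub>G\<^esub> P)"

definition parallelism :: "nat \<Rightarrow> ('a::{field,finite} ^ 2 ^ 2) set set set \<Rightarrow> bool" where
  "parallelism p \<pi> \<longleftrightarrow>
     partition_on (sylow_cosets p (SL2 :: ('a ^ 2 ^ 2) monoid)) \<pi> \<and>
     card \<pi> = CARD('a) + 1 \<and>
     (\<forall>C \<in> \<pi>. card C = CARD('a) ^ 2 - 1 \<and> disjoint C)"

text \<open>Permutations of \<open>SL2\<close> are extensional bijections, as in \<open>Bij\<close>. They act on the right,
  so the product of \<open>\<alpha>\<close> and \<open>\<beta>\<close> is first \<open>\<alpha>\<close>, then \<open>\<beta>\<close>; this is the opposite
  of the multiplication of \<open>BijGroup\<close>.\<close>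

definition PermSL2 :: "('a::field ^ 2 ^ 2 \<Rightarrow> 'a ^ 2 ^ 2) monoid" where
  "PermSL2 = \<lparr>carrier = Bij (carrier SL2),
              mult = (\<lambda>\<alpha> \<beta>. compose (carrier SL2) \<beta> \<alpha>),
              one = (\<lambda>g \<in> carrier SL2. g)\<rparr>"

definition act_on_parallelism :: "('g \<Rightarrow> 'g) \<Rightarrow> 'g set set set \<Rightarrow> 'g set set set" where
  "act_on_parallelism \<sigma> \<pi> = (\<lambda>C. (\<lambda>X. \<sigma> ` X) ` C) ` \<pi>"

definition rho :: "'a::field ^ 2 ^ 2 \<Rightarrow> 'a ^ 2 ^ 2 \<Rightarrow> 'a ^ 2 ^ 2" where
  "rho h = (\<lambda>g \<in> carrier SL2. g ** h)"

definition gamma :: "'a::field ^ 2 ^ 2 \<Rightarrow> 'a ^ 2 ^ 2 \<Rightarrow> 'a ^ 2 ^ 2" where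
  "gamma a = (\<lambda>g \<in> carrier SL2. matrix_inv a ** g ** a)"

definition right_translations :: "('a::field ^ 2 ^ 2 \<Rightarrow> 'a ^ 2 ^ 2) set" where
  "right_translations = rho ` carrier SL2"

text \<open>The group \<open>\<AA> \<ltimes> R\<close>, as a set of permutations.\<close>

definition auto_trans :: "('a::field ^ 2 ^ 2 \<Rightarrow> 'a ^ 2 ^ 2) set" where
  "auto_trans = generate PermSL2 (auto SL2 \<union> right_translations)"

definition field_automorphisms :: "('a::field \<Rightarrow> 'a) set" where
  "field_automorphisms = {\<tau>. bij \<tau> \<and> \<tau> 1 = 1 \<and>
     (\<forall>x y. \<tau> (x + y) = \<tau> x + \<tau> y) \<and> (\<forall>x y. \<tau> (x * y) = \<tau> x * \<tau> y)}"

definition PSigmaL2 :: "('a::field ^ 2 ^ 2 \<Rightarrow> 'a ^ 2 ^ 2) set" where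
  "PSigmaL2 = generate PermSL2
     (gamma ` carrier SL2 \<union>
      {\<lambda>g \<in> carrier SL2. map_matrix \<tau> g | \<tau>. \<tau> \<in> field_automorphisms})"

definition T_upper :: "('a::field ^ 2 ^ 2) set" where
  "T_upper = {vector [vector [1, x], vector [0, 1]] | x. True}"

definition Omega :: "('a::field ^ 2 ^ 2) set" where
  "Omega = {g \<in> carrier SL2. \<exists>y. g $ 2 $ 1 = y ^ 2}"

definition A_odd :: "('a::field ^ 2 ^ 2) set set" where
  "A_odd = {T_upper #>\<^bsub>SL2\<^esub> g | g. g \<in> Omega} \<union>
           {g <#\<^bsub>SL2\<^esub> T_upper | g. g \<in> carrier SL2 - Omega}"

definition pi_odd :: "('a::field ^ 2 ^ 2) set set set" where
  "pi_odd = {{(inv\<^bsub>SL2\<^esub> h <#\<^bsub>SL2\<^esub> X) #>\<^bsub>SL2\<^esub> h | X. X \<in> A_odd} | h. h \<in> carrier SL2}"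

text \<open>Internal products inside an ambient group \<open>G\<close>: \<open>L = N \<rtimes> K\<close> (with \<open>N\<close> normal)
  and \<open>L = N \<times> K\<close>.\<close>

definition internal_semidirect_product ::
    "('g, 'm) monoid_scheme \<Rightarrow> 'g set \<Rightarrow> 'g set \<Rightarrow> 'g set \<Rightarrow> bool" where
  "internal_semidirect_product G L N K \<longleftrightarrow>
     subgroup L G \<and> N \<lhd> G\<lparr>carrier := L\<rparr> \<and> subgroup K (G\<lparr>carrier := L\<rparr>) \<and>
     N \<inter> K = {\<one>\<^bsub>G\<^esub>} \<and> L = N <#>\<^bsub>G\<^esub> K"

definition internal_direct_product ::
    "('g, 'm) monoid_scheme \<Rightarrow> 'g set \<Rightarrow> 'g set \<Rightarrow> 'g set \<Rightarrow> bool" where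
  "internal_direct_product G L N K \<longleftrightarrow>
     internal_semidirect_product G L N K \<and> K \<lhd> G\<lparr>carrier := L\<rparr>"

end

theory Submission
  imports Defs
begin

text \<open>
  Every Sylow \<open>p\<close>-subgroup is the stabilizer of a nonzero column vector (a \<open>p\<close>-group acting on
  the \<open>q\<^sup>2 - 1\<close> nonzero vectors has a fixed point), so the cosets are the sets
  \<open>{g. g v = w}\<close>, given by pairs \<open>(v, w)\<close> of nonzero vectors up to a common scalar. With the
  area form \<open>[v, w]\<close>, the class of \<open>\<pi>\<^sub>o\<^sub>d\<^sub>d\<close> containing \<open>(v, w)\<close> is the one labelled by the line of
  \<open>w\<close> if \<open>[v, w]\<close> is a square and by the line of \<open>v\<close> otherwise. Since every automorphism of
  \<open>SL(2, q)\<close> has the form \<open>g \<mapsto> b \<tau>(g) b\<^sup>-\<^sup>1\<close>, the permutation it forms with the translation by \<open>h\<close>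
  acts on pairs by \<open>(v, w) \<mapsto> (h\<^sup>-\<^sup>1 b \<tau>(v), b \<tau>(w))\<close>. The pairs \<open>(v, \<lambda> v)\<close> lie in
  one class; looking at their images forces \<open>h = \<plusminus>\<one>\<close> if the permutation stabilizes \<open>\<pi>\<^sub>o\<^sub>d\<^sub>d\<close>, and for
  \<open>h = \<one>\<close> the pair of standard basis vectors shows that \<open>det b\<close> is a square. Hence \<open>P\<Sigma>L(2, q)\<close> is the
  stabilizer of \<open>\<one>\<close> in the stabilizer of \<open>\<pi>\<^sub>o\<^sub>d\<^sub>d\<close>, and any stabilizing involution moving \<open>\<one>\<close> to
  \<open>- \<one>\<close> complements it.
\<close>

section \<open>Two-dimensional matrices and vectors\<close>

definition M2 :: "'a \<Rightarrow> 'a \<Rightarrow> 'a \<Rightarrow> 'a \<Rightarrow> 'a::zero ^ 2 ^ 2" where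
  "M2 a b c d = vector [vector [a, b], vector [c, d]]"

definition V2 :: "'a \<Rightarrow> 'a \<Rightarrow> 'a::zero ^ 2" where
  "V2 a b = vector [a, b]"

lemma M2_nth [simp]: "M2 a b c d $ 1 $ 1 = a" "M2 a b c d $ 1 $ 2 = b"
    "M2 a b c d $ 2 $ 1 = c" "M2 a b c d $ 2 $ 2 = d"
  by (simp_all add: M2_def)

lemma V2_nth [simp]: "V2 a b $ 1 = a" "V2 a b $ 2 = b"
  by (simp_all add: V2_def)

lemma M2_eta: "M2 (g $ 1 $ 1) (g $ 1 $ 2) (g $ 2 $ 1) (g $ 2 $ 2) = g"
  by (simp add: vec_eq_iff forall_2)

lemma V2_eta: "V2 (v $ 1) (v $ 2) = v"
  by (simp add: vec_eq_iff forall_2)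

lemma M2_eq_iff [simp]: "M2 a b c d = M2 a' b' c' d' \<longleftrightarrow> a = a' \<and> b = b' \<and> c = c' \<and> d = d'"
  by (simp add: vec_eq_iff forall_2)

lemma V2_eq_iff [simp]: "V2 a b = V2 a' b' \<longleftrightarrow> a = a' \<and> b = b'"
  by (simp add: vec_eq_iff forall_2)

lemma M2_cases: obtains a b c d where "g = M2 a b c d"
  using M2_eta by metis

lemma V2_cases [cases type]: obtains a b where "v = V2 a b"
  using V2_eta by metis

lemma zero_V2: "0 = V2 0 0"
  by (simp add: vec_eq_iff forall_2)

lemma mat_1_M2: "mat 1 = M2 1 0 0 (1::'a::{zero,one})"
  by (simp add: vec_eq_iff forall_2 mat_def)

lemma M2_mult: "M2 a b c d ** M2 a' b' c' d' =
    M2 (a * a' + b * c') (a * b' + b * d') (c * a' + d * c') (c * b' + d * (d'::'a::semiring_1))"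
  by (simp add: vec_eq_iff forall_2 matrix_matrix_mult_def sum_2)

lemma M2_vec: "M2 a b c d *v V2 x y = V2 (a * x + b * y) (c * x + d * (y::'a::semiring_1))"
  by (simp add: vec_eq_iff forall_2 matrix_vector_mult_def sum_2)

lemma uminus_M2: "- M2 a b c d = M2 (-a) (-b) (-c) (-(d::'a::ring_1))"
  by (simp add: vec_eq_iff forall_2)

lemma uminus_V2: "- V2 a b = V2 (-a) (-(b::'a::ring_1))"
  by (simp add: vec_eq_iff forall_2)

lemma smult_V2: "r *s V2 a b = V2 (r * a) (r * (b::'a::ring_1))"
  by (simp add: vec_eq_iff forall_2)

lemma det_M2: "det (M2 a b c d) = a * d - b * (c::'a::comm_ring_1)"
  by (simp add: det_2)

lemma map_matrix_M2: "map_matrix f (M2 a b c d) = M2 (f a) (f b) (f c) (f d)"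
  by (simp add: vec_eq_iff forall_2)

section \<open>The area form on the plane and collinearity of vectors\<close>

definition area :: "'a::comm_ring_1 ^ 2 \<Rightarrow> 'a ^ 2 \<Rightarrow> 'a" where
  "area v w = v $ 1 * w $ 2 - v $ 2 * w $ 1"

lemma area_V2: "area (V2 a b) (V2 c d) = a * d - b * c"
  by (simp add: area_def)

lemmas M2_simps = zero_V2 mat_1_M2 M2_mult M2_vec uminus_M2 uminus_V2 smult_V2 det_M2 area_V2 map_matrix_M2

lemma area_mult: "area (g *v v) (g *v w) = det g * area v w"
  by (cases g rule: M2_cases; cases v; cases w) (simp add: M2_simps algebra_simps)

lemma area_smult [simp]: "area (r *s v) w = r * area v w" "area v (r *s w) = r * area v w"
  by (simp_all add: area_def algebra_simps)

lemma area_uminus [simp]: "area (- v) w = - area v w" "area v (- w) = - area v w"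
  by (simp_all add: area_def algebra_simps)

lemma area_self [simp]: "area v v = 0"
  by (simp add: area_def algebra_simps)

lemma area_commute: "area v w = - area w v"
  by (simp add: area_def algebra_simps)

lemma area_eq_0_iff:
  fixes v w :: "'a::field ^ 2"
  assumes "v \<noteq> 0"
  shows "area v w = 0 \<longleftrightarrow> (\<exists>r. w = r *s v)"
proof
  assume *: "area v w = 0"
  obtain a b c d where vw: "v = V2 a b" "w = V2 c d"
    using V2_cases by metis
  have ab: "a \<noteq> 0 \<or> b \<noteq> 0" using assms by (simp add: vw M2_simps)
  have "w = (c / a) *s v" if "a \<noteq> 0"
    using * that by (simp add: vw M2_simps field_simps)
  moreover have "w = (d / b) *s v" if "b \<noteq> 0"
    using * that by (simp add: vw M2_simps field_simps)
  ultimately show "\<exists>r. w = r *s v" using ab by blast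
qed auto

lemma area_eq_0D:
  fixes v w :: "'a::field ^ 2"
  assumes "v \<noteq> 0" "w \<noteq> 0" "area v w = 0"
  obtains r where "r \<noteq> 0" "w = r *s v"
proof -
  obtain r where "w = r *s v" using assms(1,3) area_eq_0_iff by blast
  then show thesis using assms(2) that by (cases "r = 0") auto
qed

text \<open>Both \<open>u\<close> and \<open>v\<close> lie on the line spanned by \<open>w\<close>.
  Collinearity is transitive only through a nonzero middle vector, hence
  \<open>w \<noteq> 0\<close>.\<close>

lemma area_eq_0_trans:
  fixes u v w :: "'a::field ^ 2"
  assumes "w \<noteq> 0" "area w u = 0" "area w v = 0"
  shows "area u v = 0"
proof -
  obtain r s where "u = r *s w" "v = s *s w" using assms area_eq_0_iff by blast
  then show ?thesis by simp
qed

section \<open>Cosets as transporters\<close>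

lemma carrier_SL2: "g \<in> carrier SL2 \<longleftrightarrow> det g = 1"
  and mult_SL2 [simp]: "g \<otimes>\<^bsub>SL2\<^esub> h = g ** h"
  and one_SL2 [simp]: "\<one>\<^bsub>SL2\<^esub> = mat 1"
  by (simp_all add: SL2_def)

text \<open>The adjugate inverts every matrix of determinant 1 and is polynomial in the entries, so
  identities for inverses in \<open>SL2\<close> become ring identities, in contrast to the
  choice-based \<open>matrix_inv\<close>.\<close>

definition adj :: "'a::comm_ring_1 ^ 2 ^ 2 \<Rightarrow> 'a ^ 2 ^ 2" where
  "adj g = M2 (g $ 2 $ 2) (- g $ 1 $ 2) (- g $ 2 $ 1) (g $ 1 $ 1)"

lemma adj_SL2:
  assumes "det g = 1"
  shows "adj g ** g = mat 1" "g ** adj g = mat 1" "det (adj g) = 1"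
  using assms by (cases g rule: M2_cases; simp add: M2_simps adj_def algebra_simps)+

lemma group_SL2: "group (SL2 :: ('a::field ^ 2 ^ 2) monoid)"
proof (rule groupI)
  show "\<exists>y\<in>carrier SL2. y \<otimes>\<^bsub>SL2\<^esub> x = \<one>\<^bsub>SL2\<^esub>" if "x \<in> carrier SL2" for x :: "'a ^ 2 ^ 2"
    using that by (intro bexI[of _ "adj x"]) (auto simp: carrier_SL2 adj_SL2)
qed (auto simp: carrier_SL2 det_mul matrix_mul_assoc)

lemma SL2_closed [simp, intro]:
  "g \<in> carrier SL2 \<Longrightarrow> h \<in> carrier SL2 \<Longrightarrow> g ** h \<in> carrier SL2"
  "mat 1 \<in> carrier SL2"
  by (auto simp: carrier_SL2 det_mul)

lemma inv_SL2 [simp]: "g \<in> carrier SL2 \<Longrightarrow> inv\<^bsub>SL2\<^esub> g = adj (g :: 'a::field ^ 2 ^ 2)"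
  by (rule group.inv_equality[OF group_SL2]) (auto simp: adj_SL2 carrier_SL2)

lemma adj_closed [simp, intro]: "g \<in> carrier SL2 \<Longrightarrow> adj g \<in> carrier SL2"
  by (simp add: carrier_SL2 adj_SL2)

lemma adj_mult [simp]:
  assumes "g \<in> carrier SL2"
  shows "adj g ** g = mat 1" "g ** adj g = mat 1"
  using assms by (auto simp: adj_SL2 carrier_SL2)

lemma adj_cancel [simp]:
  assumes "g \<in> carrier SL2"
  shows "h ** adj g ** g = h" "h ** g ** adj g = h"
    "adj g ** (g ** h) = h" "g ** (adj g ** h) = h"
    "adj g *v (g *v v) = v" "g *v (adj g *v v) = v"
  using assms
  by (simp_all add: matrix_mul_assoc matrix_vector_mul_assoc
      flip: matrix_mul_assoc[of h g] matrix_mul_assoc[of h "adj g"])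

lemma SL2_vec_eq_0_iff [simp]: "g \<in> carrier SL2 \<Longrightarrow> g *v v = 0 \<longleftrightarrow> v = 0"
  by (metis adj_cancel(5) matrix_vector_mult_0_right)

lemma area_SL2 [simp]: "g \<in> carrier SL2 \<Longrightarrow> area (g *v v) (g *v w) = area v w"
  by (simp add: area_mult carrier_SL2)

lemma adj_vec_eq_iff: "g \<in> carrier SL2 \<Longrightarrow> adj g *v v = w \<longleftrightarrow> v = g *v w"
  by auto

text \<open>For nonzero \<open>v\<close> and \<open>w\<close> this is at once a left coset of the
  stabilizer of \<open>v\<close> and a right coset of the stabilizer of \<open>w\<close>. Right
  multiplication changes only the source vector and left multiplication only the target vector,
  which is what makes the pair \<open>(v, w)\<close> a good coordinate for cosets.\<close>

definition transporter :: "'a::field ^ 2 \<Rightarrow> 'a ^ 2 \<Rightarrow> ('a ^ 2 ^ 2) set" where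
  "transporter v w = {g \<in> carrier SL2. g *v v = w}"

lemma transporter_subset: "transporter v w \<subseteq> carrier SL2"
  by (auto simp: transporter_def)

lemma transporter_r_coset:
  assumes "g \<in> carrier SL2"
  shows "transporter v w #>\<^bsub>SL2\<^esub> g = transporter (adj g *v v) w"
proof -
  have "y \<in> (\<lambda>x. x ** g) ` transporter v w" if "y \<in> transporter (adj g *v v) w" for y
    using that assms by (intro image_eqI[of _ _ "y ** adj g"]) (auto simp: transporter_def matrix_vector_mul_assoc)
  then show ?thesis using assms
    by (auto simp: r_coset_def transporter_def matrix_vector_mul_assoc[symmetric])
qed

lemma transporter_l_coset:
  assumes "g \<in> carrier SL2"
  shows "g <#\<^bsub>SL2\<^esub> transporter v w = transporter v (g *v w)"
proof -
  have "y \<in> (\<lambda>x. g ** x) ` transporter v w" if "y \<in> transporter v (g *v w)" for y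
    using that assms by (intro image_eqI[of _ _ "adj g ** y"]) (auto simp: transporter_def matrix_vector_mul_assoc[symmetric])
  then show ?thesis using assms
    by (auto simp: l_coset_def transporter_def matrix_vector_mul_assoc[symmetric])
qed

lemma T_upper_eq: "T_upper = transporter (V2 1 0) (V2 1 0)"
proof -
  have "\<exists>x. g = M2 1 x 0 1" if "g \<in> transporter (V2 1 0) (V2 1 0)" for g
    using that by (cases g rule: M2_cases) (auto simp: transporter_def carrier_SL2 M2_simps)
  then show ?thesis
    by (fastforce simp: T_upper_def transporter_def carrier_SL2 M2_simps simp flip: M2_def)
qed

lemma SL2_transitive:
  fixes v w :: "'a::field ^ 2"
  assumes "v \<noteq> 0" "w \<noteq> 0"
  shows "transporter v w \<noteq> {}"
proof -
  have *: "\<exists>g \<in> carrier SL2. g *v V2 1 0 = v" if nz: "v \<noteq> 0" for v :: "'a ^ 2"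
  proof (cases v)
    case (1 a b)
    have ab: "a \<noteq> 0 \<or> b \<noteq> 0" using nz by (simp add: 1 M2_simps)
    \<comment> \<open>The vector becomes the first column; the second column completes it to
      determinant 1 and depends on which coordinate can be inverted.\<close>
    have "a \<noteq> 0 \<Longrightarrow> ?thesis" by (rule bexI[of _ "M2 a 0 b (1/a)"]) (auto simp: 1 M2_simps carrier_SL2)
    moreover have "b \<noteq> 0 \<Longrightarrow> ?thesis" by (rule bexI[of _ "M2 a (-1/b) b 0"]) (auto simp: 1 M2_simps carrier_SL2)
    ultimately show ?thesis using ab by blast
  qed
  obtain g h where gh: "g \<in> carrier SL2" "g *v V2 1 0 = v" "h \<in> carrier SL2" "h *v V2 1 0 = w"
    using *[OF assms(1)] *[OF assms(2)] by blast
  then have "h ** adj g \<in> transporter v w"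
    by (auto simp: transporter_def matrix_vector_mul_assoc[symmetric] adj_vec_eq_iff)
  then show ?thesis by blast
qed

lemma transporter_l_bij:
  assumes "g \<in> carrier SL2"
  shows "card (transporter v (g *v w)) = card (transporter v w)"
proof -
  have "inj_on ((**) g) (transporter v w)"
    by (rule inj_on_inverseI[of _ "(**) (adj g)"]) (simp add: assms)
  from card_image[OF this] show ?thesis
    by (simp add: transporter_l_coset[OF assms, symmetric] l_coset_def UNION_singleton_eq_range)
qed

lemma transporter_r_bij:
  assumes "g \<in> carrier SL2"
  shows "card (transporter (g *v v) w) = card (transporter v w)"
proof -
  have "inj_on (\<lambda>x. x ** adj g) (transporter v w)"
    by (rule inj_on_inverseI[of _ "\<lambda>x. x ** g"]) (simp add: assms)
  from card_image[OF this] have "card (transporter v w #>\<^bsub>SL2\<^esub> adj g) = card (transporter v w)"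
    by (simp add: r_coset_def UNION_singleton_eq_range)
  moreover have "adj (adj g) = g" by (simp add: adj_def M2_eta)
  ultimately show ?thesis using assms by (simp add: transporter_r_coset)
qed

text \<open>Transitivity moves both vectors to the first standard basis vector without changing the
  cardinality. There the set is \<open>T_upper\<close>, parametrized by its upper right
  entry.\<close>

lemma card_transporter:
  fixes v w :: "'a::{field,finite} ^ 2"
  assumes "v \<noteq> 0" "w \<noteq> 0"
  shows "card (transporter v w) = CARD('a)"
proof -
  have "V2 1 0 \<noteq> (0 :: 'a ^ 2)" by (simp add: M2_simps)
  then obtain g h where "g \<in> carrier SL2" "g *v V2 1 0 = v" "h \<in> carrier SL2" "h *v V2 1 0 = w"
    using SL2_transitive[OF _ assms(1)] SL2_transitive[OF _ assms(2)] that
    unfolding transporter_def by (metis (mono_tags, lifting) Collect_empty_eq)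
  then have "card (transporter v w) = card (T_upper :: ('a ^ 2 ^ 2) set)"
    using transporter_l_bij[of h "g *v V2 1 0" "V2 1 0"] transporter_r_bij[of g "V2 1 0" "V2 1 0"]
    by (simp add: T_upper_eq)
  also have "T_upper = range (\<lambda>x. M2 1 x 0 (1::'a))"
    by (auto simp: T_upper_def M2_def)
  also have "card \<dots> = CARD('a)"
    by (rule card_image) (simp add: inj_on_def)
  finally show ?thesis .
qed

text \<open>The coset remembers the line of its source vector, because it is closed under right
  multiplication by the transvections along that line. Evaluating any member at \<open>v\<close> and
  at \<open>v'\<close> then shows that the target is rescaled by the same scalar.\<close>

lemma transporter_eq_iff:
  fixes v w :: "'a::field ^ 2"
  assumes "v \<noteq> 0" "w \<noteq> 0" "v' \<noteq> 0"
  shows "transporter v w = transporter v' w' \<longleftrightarrow> (\<exists>r. r \<noteq> 0 \<and> v' = r *s v \<and> w' = r *s w)"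
proof
  assume eq: "transporter v w = transporter v' w'"
  obtain g where g: "g \<in> transporter v w" using SL2_transitive[OF assms(1,2)] by blast
  obtain a b where v: "v = V2 a b" by (cases v)
  let ?t = "M2 (1 - a * b) (a * a) (- (b * b)) (1 + a * b)" \<comment> \<open>the transvection \<open>x \<mapsto> x + area v x v\<close>\<close>
  have t: "?t \<in> carrier SL2" "?t *v v = v" by (auto simp: carrier_SL2 M2_simps v algebra_simps)
  then have "g ** ?t \<in> transporter v w" using g by (simp add: transporter_def matrix_vector_mul_assoc[symmetric])
  then have "g *v (?t *v v') = g *v v'" using g unfolding eq by (simp add: transporter_def matrix_vector_mul_assoc)
  then have "adj g *v (g *v (?t *v v')) = adj g *v (g *v v')" by (rule arg_cong)
  then have "?t *v v' = v'" using g by (simp add: transporter_def)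
  \<comment> \<open>The transvection moves \<open>v'\<close> by \<open>area v v'\<close> times
    \<open>v\<close>, and the two coordinates of this displacement vanish.\<close>
  then have "a * area v v' = 0 \<and> b * area v v' = 0"
    by (cases v') (simp add: v M2_simps algebra_simps)
  then have "area v v' = 0" using assms by (auto simp: v M2_simps)
  then obtain r where r: "v' = r *s v" using assms by (auto simp: area_eq_0_iff)
  have "g *v v = w" using g by (simp add: transporter_def)
  moreover have "g *v v' = w'" using g unfolding eq by (simp add: transporter_def)
  ultimately have w: "w' = r *s w" by (simp add: r vector_scalar_commute)
  have "r \<noteq> 0" using assms r by auto
  then show "\<exists>r. r \<noteq> 0 \<and> v' = r *s v \<and> w' = r *s w" using r w by blast
next
  show "transporter v w = transporter v' w'" if "\<exists>r. r \<noteq> 0 \<and> v' = r *s v \<and> w' = r *s w"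
    using that by (auto simp: transporter_def vector_scalar_commute)
qed

section \<open>Sylow subgroups\<close>

lemma SL2_stabilizer_subgroup: "subgroup (transporter v v) SL2"
proof (rule group.subgroupI[OF group_SL2])
  show "inv\<^bsub>SL2\<^esub> g \<in> transporter v v" if "g \<in> transporter v v" for g
    using that by (auto simp: transporter_def adj_vec_eq_iff)
  have "mat 1 \<in> transporter v v" by (simp add: transporter_def)
  then show "transporter v v \<noteq> {}" by blast
qed (auto simp: transporter_def matrix_vector_mul_assoc[symmetric])

lemma card_nonzero_vectors: "card {v :: 'a::{field,finite} ^ 2. v \<noteq> 0} = CARD('a) ^ 2 - 1"
proof -
  have "{v :: 'a ^ 2. v \<noteq> 0} = UNIV - {0}" by auto
  then show ?thesis by (simp add: card_Diff_singleton)
qed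

text \<open>Orbit counting: without a fixed vector, every orbit of \<open>P\<close> on nonzero
  vectors has a length that is a power of \<open>p\<close> other than 1, so \<open>p\<close> would
  divide their number \<open>CARD('a) ^ 2 - 1\<close>.\<close>

lemma p_group_fixes_vector:
  fixes P :: "('a::{field,finite} ^ 2 ^ 2) set"
  assumes P: "subgroup P SL2" "card P = p ^ n" and p: "prime p" "\<not> p dvd CARD('a) ^ 2 - 1"
  shows "\<exists>v. v \<noteq> 0 \<and> P \<subseteq> transporter v v"
proof (rule ccontr)
  assume contr: "\<not> ?thesis"
  have sub: "P \<subseteq> carrier SL2" using P(1) by (rule subgroup.subset)
  have mult: "g ** h \<in> P" if "g \<in> P" "h \<in> P" for g h
    using subgroup.m_closed[OF P(1) that] by simp
  have inv: "adj g \<in> P" if "g \<in> P" for g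
    using subgroup.m_inv_closed[OF P(1) that] that sub by (simp add: subset_iff)
  have one: "mat 1 \<in> P" using subgroup.one_closed[OF P(1)] by simp
  define orb where "orb = (\<lambda>v. (\<lambda>g. g *v v) ` P)"
  have orb_self: "v \<in> orb v" for v
    unfolding orb_def by (rule image_eqI[OF _ one]) simp
  have p_dvd: "p dvd card (orb v)" if v: "v \<noteq> 0" for v
  proof -
    \<comment> \<open>Left multiplication by \<open>h\<close> carries the stabilizer of
      \<open>v\<close> bijectively to the fibre over \<open>h *v v\<close>. Equal fibres give the
      orbit-stabilizer formula below.\<close>
    have fib: "card {g \<in> P. g *v v = w} = card {g \<in> P. g *v v = v}" if w: "w \<in> orb v" for w
    proof -
      obtain h where h: "h \<in> P" "w = h *v v" using w by (auto simp: orb_def)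
      have hS: "h \<in> carrier SL2" using h sub by blast
      have "bij_betw ((**) h) {g \<in> P. g *v v = v} {g \<in> P. g *v v = w}"
        by (rule bij_betw_byWitness[of _ "(**) (adj h)"])
          (use h hS inv mult in \<open>auto simp: matrix_vector_mul_assoc[symmetric]\<close>)
      then show ?thesis by (simp add: bij_betw_same_card)
    qed
    have "card P = (\<Sum>w \<in> orb v. card {g \<in> P. g *v v = w})"
      unfolding orb_def card_eq_sum by (rule sum.image_gen) simp
    also have "\<dots> = card (orb v) * card {g \<in> P. g *v v = v}"
      using fib by simp
    finally have "card (orb v) dvd p ^ n" using P(2) by simp
    then obtain i where i: "card (orb v) = p ^ i" using p(1) divides_primepow_nat by blast
    have "card (orb v) \<noteq> 1"
    proof
      assume "card (orb v) = 1"
      then have "orb v = {v}" using orb_self[of v] by (metis card_1_singletonE singletonD)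
      then have "P \<subseteq> transporter v v" using sub by (auto simp: orb_def transporter_def)
      then show False using contr v by blast
    qed
    then show ?thesis using i by (cases i) auto
  qed
  have disj: "orb v = orb w" if "u \<in> orb v" "u \<in> orb w" for u v w :: "'a ^ 2"
  proof -
    have *: "orb w \<subseteq> orb v" if u: "u \<in> orb v" "u \<in> orb w" for v w
    proof -
      obtain g h where gh: "g \<in> P" "h \<in> P" "u = g *v v" "u = h *v w" using u by (auto simp: orb_def)
      then have "w = adj h *v (g *v v)" using sub adj_vec_eq_iff by (metis subsetD)
      then have "f *v w = (f ** adj h ** g) *v v" for f by (simp add: matrix_vector_mul_assoc matrix_mul_assoc)
      moreover have "f ** adj h ** g \<in> P" if "f \<in> P" for f using that mult inv gh by blast
      ultimately show ?thesis unfolding orb_def by blast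
    qed
    show ?thesis using *[OF that] *[OF that(2,1)] by blast
  qed
  have U: "\<Union>(orb ` {v. v \<noteq> 0}) = {v. v \<noteq> 0}"
    using orb_self sub by (fastforce simp: orb_def)
  have "p dvd card (\<Union>(orb ` {v. v \<noteq> 0}))"
  proof (rule dvd_partition)
    show "\<forall>c \<in> orb ` {v. v \<noteq> 0}. p dvd card c" using p_dvd by simp
    show "\<forall>c1 \<in> orb ` {v. v \<noteq> 0}. \<forall>c2 \<in> orb ` {v. v \<noteq> 0}. c1 \<noteq> c2 \<longrightarrow> c1 \<inter> c2 = {}"
    proof (intro ballI impI)
      fix c1 c2 assume *: "c1 \<in> orb ` {v. v \<noteq> 0}" "c2 \<in> orb ` {v. v \<noteq> 0}" "c1 \<noteq> c2"
      then obtain v w where vw: "c1 = orb v" "c2 = orb w" by auto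
      have "u \<notin> orb w" if "u \<in> orb v" for u using disj[OF that, of w] *(3) vw by auto
      then show "c1 \<inter> c2 = {}" using vw by auto
    qed
  qed simp
  then show False using p(2) by (simp add: U card_nonzero_vectors)
qed

text \<open>Sort the elements by the image of the first basis vector: every nonzero vector occurs,
  and each fibre is a transporter.\<close>

lemma order_SL2: "Coset.order (SL2 :: ('a::{field,finite} ^ 2 ^ 2) monoid) = CARD('a) * (CARD('a) ^ 2 - 1)"
proof -
  let ?S = "carrier SL2 :: ('a ^ 2 ^ 2) set" and ?e = "V2 1 0 :: 'a ^ 2"
  have e: "?e \<noteq> 0" by (simp add: M2_simps)
  have im: "(\<lambda>g. g *v ?e) ` ?S = {v. v \<noteq> 0}"
    using SL2_transitive[OF e] e by (fastforce simp: transporter_def)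
  have "card ?S = (\<Sum>w \<in> (\<lambda>g. g *v ?e) ` ?S. card {g \<in> ?S. g *v ?e = w})"
    unfolding card_eq_sum by (rule sum.image_gen) simp
  also have "\<dots> = (\<Sum>w \<in> {v :: 'a ^ 2. v \<noteq> 0}. CARD('a))"
    unfolding im using card_transporter[OF e] by (intro sum.cong) (auto simp: transporter_def)
  finally show ?thesis by (simp add: card_nonzero_vectors Coset.order_def)
qed

lemma prime_not_dvd_power_minus_1:
  assumes "prime (p::nat)" "p dvd q" "q > 0" "n > 0"
  shows "\<not> p dvd q ^ n - 1"
proof
  assume "p dvd q ^ n - 1"
  moreover have "p dvd q ^ n" using assms by (simp add: dvd_power_iff_le dvd_trans dvd_power)
  ultimately have "p dvd q ^ n - (q ^ n - 1)" by (rule dvd_diff_nat[rotated])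
  moreover have "q ^ n - (q ^ n - 1) = 1" using assms by simp
  ultimately show False using assms by simp
qed

text \<open>As \<open>p\<close> does not divide \<open>CARD('a) ^ 2 - 1\<close>, the Sylow order is
  \<open>CARD('a)\<close>. A Sylow subgroup fixes a nonzero vector, so it lies in the stabilizer of
  that vector, which has the same order.\<close>

lemma sylow_subgroups_SL2:
  assumes "prime p" "e \<ge> 1" "CARD('a) = p ^ e"
  shows "sylow_subgroups p (SL2 :: ('a::{field,finite} ^ 2 ^ 2) monoid) = {transporter v v | v. v \<noteq> 0}"
proof -
  have ndvd: "\<not> p dvd CARD('a) ^ 2 - 1"
    by (rule prime_not_dvd_power_minus_1) (use assms prime_gt_0_nat[of p] in auto)
  then have "multiplicity p (CARD('a) * (CARD('a) ^ 2 - 1)) = e"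
    using assms by (subst mult.commute, subst multiplicity_prime_elem_times_other)
      (auto simp: multiplicity_same_power)
  then have *: "P \<in> sylow_subgroups p (SL2 :: ('a ^ 2 ^ 2) monoid) \<longleftrightarrow> subgroup P SL2 \<and> card P = CARD('a)" for P
    by (simp add: sylow_subgroups_def order_SL2 assms(3))
  show ?thesis
  proof (intro equalityI subsetI)
    fix P :: "('a ^ 2 ^ 2) set"
    assume P: "P \<in> sylow_subgroups p SL2"
    then obtain v where v: "v \<noteq> 0" "P \<subseteq> transporter v v"
      using p_group_fixes_vector[of P p e] assms ndvd by (auto simp: *)
    then have "P = transporter v v"
      using P by (intro card_subset_eq) (auto simp: * card_transporter)
    then show "P \<in> {transporter v v | v. v \<noteq> 0}" using v by blast
  qed (auto simp: * card_transporter SL2_stabilizer_subgroup)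
qed

text \<open>A transporter from \<open>v\<close> to \<open>w\<close> is a right coset of the
  stabilizer of its target \<open>w\<close>, represented by any of its elements.\<close>

lemma sylow_cosets_SL2:
  assumes "prime p" "e \<ge> 1" "CARD('a) = p ^ e"
  shows "sylow_cosets p (SL2 :: ('a::{field,finite} ^ 2 ^ 2) monoid) =
    {transporter v w | v w. v \<noteq> 0 \<and> w \<noteq> 0}"
proof -
  have *: "\<exists>u. u \<noteq> 0 \<and> (\<exists>g \<in> carrier SL2. transporter v w = transporter u u #>\<^bsub>SL2\<^esub> g)"
    if vw: "v \<noteq> 0" "w \<noteq> 0" for v w :: "'a ^ 2"
  proof -
    obtain g where g: "g \<in> carrier SL2" "g *v v = w"
      using SL2_transitive[OF vw] by (auto simp: transporter_def)
    then have "transporter v w = transporter w w #>\<^bsub>SL2\<^esub> g" by (auto simp: transporter_r_coset)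
    then show ?thesis using g vw by blast
  qed
  have mem: "X \<in> sylow_cosets p SL2 \<longleftrightarrow>
    (\<exists>u g. X = transporter u u #>\<^bsub>SL2\<^esub> g \<and> u \<noteq> 0 \<and> g \<in> carrier SL2)" for X :: "('a ^ 2 ^ 2) set"
    by (auto simp: sylow_cosets_def sylow_subgroups_SL2[OF assms] RCOSETS_def)
  show ?thesis
  proof (intro equalityI subsetI)
    fix X :: "('a ^ 2 ^ 2) set" assume "X \<in> sylow_cosets p SL2"
    then obtain u g where "X = transporter u u #>\<^bsub>SL2\<^esub> g" "u \<noteq> 0" and g: "g \<in> carrier SL2"
      unfolding mem by blast
    then have "X = transporter (adj g *v u) u" "adj g *v u \<noteq> 0" "u \<noteq> 0"
      using adj_closed[OF g] by (simp_all add: transporter_r_coset)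
    then show "X \<in> {transporter v w | v w. v \<noteq> 0 \<and> w \<noteq> 0}" by blast
  next
    fix X :: "('a ^ 2 ^ 2) set" assume "X \<in> {transporter v w | v w. v \<noteq> 0 \<and> w \<noteq> 0}"
    then obtain v w where "X = transporter v w" "v \<noteq> 0" "w \<noteq> 0" by blast
    then show "X \<in> sylow_cosets p SL2" unfolding mem using *[of v w] by metis
  qed
qed

section \<open>The parallelism\<close>

definition is_square :: "'a::semiring_1 \<Rightarrow> bool" where
  "is_square x \<longleftrightarrow> (\<exists>y. x = y ^ 2)"

lemma is_square_0 [simp]: "is_square 0" and is_square_1 [simp]: "is_square 1"
  by (auto simp: is_square_def intro: exI[of _ 0] exI[of _ 1])

text \<open>Rescaling both vectors of a pair multiplies their area by a nonzero square. The nested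
  form \<open>r * (r * x)\<close> is the one that \<open>area_smult\<close> produces.\<close>

lemma is_square_mult_sq [simp]:
  fixes r :: "'a::field"
  assumes "r \<noteq> 0"
  shows "is_square (r * (r * x)) \<longleftrightarrow> is_square x"
proof
  assume "is_square (r * (r * x))"
  then obtain y where y: "r * (r * x) = y ^ 2" by (auto simp: is_square_def)
  then have "x = (y / r) ^ 2" using assms by (simp add: field_simps power2_eq_square)
  then show "is_square x" unfolding is_square_def by blast
next
  assume "is_square x"
  then obtain y where "x = y ^ 2" by (auto simp: is_square_def)
  then have "r * (r * x) = (r * y) ^ 2" by (simp add: power2_eq_square)
  then show "is_square (r * (r * x))" unfolding is_square_def by blast
qed

text \<open>The class of \<open>\<pi>\<^sub>o\<^sub>d\<^sub>d\<close> belonging to the point of the projective line spanned by \<open>u\<close>.\<close>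

definition cls :: "'a::field ^ 2 \<Rightarrow> ('a ^ 2 ^ 2) set set" where
  "cls u = {transporter v u | v. v \<noteq> 0 \<and> is_square (area v u)} \<union>
           {transporter u w | w. \<not> is_square (area u w)}"

text \<open>The criterion does not depend on the pair representing the coset: another pair differs
  by a common nonzero scalar, which affects neither the two lines nor whether the area is a
  square.\<close>

lemma transporter_in_cls_iff:
  fixes u v w :: "'a::field ^ 2"
  assumes nz: "u \<noteq> 0" "v \<noteq> 0" "w \<noteq> 0"
  shows "transporter v w \<in> cls u \<longleftrightarrow> (if is_square (area v w) then area w u = 0 else area v u = 0)"
proof
  assume "transporter v w \<in> cls u"
  then consider v' where "v' \<noteq> 0" "is_square (area v' u)" "transporter v w = transporter v' u"
    | w' where "\<not> is_square (area u w')" "transporter v w = transporter u w'"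
    by (auto simp: cls_def)
  then show "if is_square (area v w) then area w u = 0 else area v u = 0"
    by cases (use nz in \<open>auto simp: transporter_eq_iff\<close>)
next
  assume *: "if is_square (area v w) then area w u = 0 else area v u = 0"
  show "transporter v w \<in> cls u"
  proof (cases "is_square (area v w)")
    case True
    then obtain r where r: "r \<noteq> 0" "u = r *s w" using * nz area_eq_0D by (metis (full_types))
    then have "transporter v w = transporter (r *s v) u" "is_square (area (r *s v) u)"
      using nz True by (auto simp: transporter_eq_iff)
    then show ?thesis using r nz by (auto simp: cls_def)
  next
    case False
    then obtain r where r: "r \<noteq> 0" "u = r *s v" using * nz area_eq_0D by (metis (full_types))
    then have "transporter v w = transporter u (r *s w)" "\<not> is_square (area u (r *s w))"
      using nz False by (auto simp: transporter_eq_iff)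
    then show ?thesis by (auto simp: cls_def)
  qed
qed

lemma clsE:
  assumes "X \<in> cls u" "u \<noteq> 0"
  obtains v w where "X = transporter v w" "v \<noteq> 0" "w \<noteq> 0"
proof -
  have "w \<noteq> 0" if "\<not> is_square (area u w)" for w using that by (auto simp: area_def)
  then show ?thesis using assms that by (auto simp: cls_def)
qed

text \<open>The coset of the pair \<open>(u, u)\<close> has area 0 and so detects the label: it lies
  in \<open>cls v\<close> only if \<open>u\<close> and \<open>v\<close> span the same line. Thus
  classes correspond to points of the projective line.\<close>

lemma cls_eq_iff:
  fixes u v :: "'a::field ^ 2"
  assumes nz: "u \<noteq> 0" "v \<noteq> 0"
  shows "cls u = cls v \<longleftrightarrow> area u v = 0"
proof
  assume "cls u = cls v"
  then have "transporter u u \<in> cls v" using nz transporter_in_cls_iff[of u u u] by auto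
  then show "area u v = 0" using nz by (auto simp: transporter_in_cls_iff)
next
  assume uv: "area u v = 0"
  have *: "cls u \<subseteq> cls v" if nz: "u \<noteq> 0" "v \<noteq> 0" and uv: "area u v = 0" for u v :: "'a ^ 2"
  proof
    fix X assume X: "X \<in> cls u"
    then obtain x y where "X = transporter x y" "x \<noteq> 0" "y \<noteq> 0" using nz by (blast elim: clsE)
    then show "X \<in> cls v" using X nz uv area_eq_0_trans[of u _ v]
      by (auto simp: transporter_in_cls_iff area_commute[of u] split: if_splits)
  qed
  show "cls u = cls v" using *[OF nz uv] *[OF nz(2,1)] uv area_commute[of u v] by auto
qed

lemma cls_inter:
  fixes u v :: "'a::field ^ 2"
  assumes nz: "u \<noteq> 0" "v \<noteq> 0" and X: "X \<in> cls u" "X \<in> cls v"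
  shows "cls u = cls v"
proof -
  obtain x y where "X = transporter x y" "x \<noteq> 0" "y \<noteq> 0" using X nz by (blast elim: clsE)
  then show ?thesis using X nz area_eq_0_trans[of _ u v]
    by (auto simp: transporter_in_cls_iff cls_eq_iff split: if_splits)
qed

text \<open>With \<open>?e\<close> the first basis vector, the right coset of \<open>T_upper\<close>
  by \<open>g\<close> transports \<open>adj g *v ?e\<close> to \<open>?e\<close>, and the left coset
  transports \<open>?e\<close> to \<open>g *v ?e\<close>. Both pairs have the lower left entry of
  \<open>g\<close> as their area, so membership in \<open>Omega\<close> turns into a condition on
  areas.\<close>

lemma A_odd_eq: "A_odd = cls (V2 1 (0 :: 'a::field))"
proof -
  let ?e = "V2 1 0 :: 'a ^ 2"
  have e: "?e \<noteq> 0" by (simp add: M2_simps)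
  have area: "area (adj g *v ?e) ?e = g $ 2 $ 1" "area ?e (g *v ?e) = g $ 2 $ 1" for g :: "'a ^ 2 ^ 2"
    by (cases g rule: M2_cases; simp add: adj_def M2_simps)+
  have Omega: "g \<in> Omega \<longleftrightarrow> g \<in> carrier SL2 \<and> is_square (g $ 2 $ 1)" for g :: "'a ^ 2 ^ 2"
    by (simp add: Omega_def is_square_def)
  have L: "\<exists>g \<in> carrier SL2. v = adj g *v ?e" if v: "v \<noteq> 0" for v
  proof -
    obtain g where "g \<in> carrier SL2" "g *v v = ?e"
      using SL2_transitive[OF v e] by (auto simp: transporter_def)
    then show ?thesis by (metis adj_cancel(5))
  qed
  have R: "\<exists>g \<in> carrier SL2. w = g *v ?e" if "w \<noteq> 0" for w
    using SL2_transitive[OF e that] by (force simp: transporter_def)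
  have nz: "w \<noteq> 0" if "\<not> is_square (area ?e w)" for w using that by (auto simp: area_def)
  have "{T_upper #>\<^bsub>SL2\<^esub> g | g. g \<in> Omega} = {transporter (adj g *v ?e) ?e | g. g \<in> Omega}"
    unfolding Setcompr_eq_image by (intro image_cong) (auto simp: Omega T_upper_eq transporter_r_coset)
  also have "\<dots> = {transporter v ?e | v. v \<noteq> 0 \<and> is_square (area v ?e)}"
  proof (intro equalityI subsetI)
    fix X assume "X \<in> {transporter v ?e | v. v \<noteq> 0 \<and> is_square (area v ?e)}"
    then obtain v where v: "X = transporter v ?e" "v \<noteq> 0" "is_square (area v ?e)" by blast
    then obtain g where g: "g \<in> carrier SL2" "v = adj g *v ?e" using L by blast
    then have "g \<in> Omega" using v area(1)[of g] by (simp add: Omega)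
    then show "X \<in> {transporter (adj g *v ?e) ?e | g. g \<in> Omega}" using v g by blast
  next
    fix X assume "X \<in> {transporter (adj g *v ?e) ?e | g. g \<in> Omega}"
    then obtain g where g: "X = transporter (adj g *v ?e) ?e" "g \<in> Omega" by blast
    then have "adj g *v ?e \<noteq> 0" "is_square (area (adj g *v ?e) ?e)" using e adj_closed[of g] by (simp_all add: Omega area)
    then show "X \<in> {transporter v ?e | v. v \<noteq> 0 \<and> is_square (area v ?e)}" using g by blast
  qed
  finally have 1: "{T_upper #>\<^bsub>SL2\<^esub> g | g. g \<in> Omega} = {transporter v ?e | v. v \<noteq> 0 \<and> is_square (area v ?e)}" .
  have "{g <#\<^bsub>SL2\<^esub> T_upper | g. g \<in> carrier SL2 - Omega} = {transporter ?e (g *v ?e) | g. g \<in> carrier SL2 - Omega}"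
    unfolding Setcompr_eq_image by (intro image_cong) (auto simp: Omega T_upper_eq transporter_l_coset)
  also have "\<dots> = {transporter ?e w | w. \<not> is_square (area ?e w)}"
  proof (intro equalityI subsetI)
    fix X assume "X \<in> {transporter ?e w | w. \<not> is_square (area ?e w)}"
    then obtain w where w: "X = transporter ?e w" "\<not> is_square (area ?e w)" by blast
    then obtain g where g: "g \<in> carrier SL2" "w = g *v ?e" using R nz by blast
    then have "g \<notin> Omega" using w area(2)[of g] by (simp add: Omega)
    then show "X \<in> {transporter ?e (g *v ?e) | g. g \<in> carrier SL2 - Omega}" using w g by blast
  next
    fix X assume "X \<in> {transporter ?e (g *v ?e) | g. g \<in> carrier SL2 - Omega}"
    then obtain g where g: "X = transporter ?e (g *v ?e)" "g \<in> carrier SL2 - Omega" by blast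
    then have "\<not> is_square (area ?e (g *v ?e))" by (simp add: Omega area)
    then show "X \<in> {transporter ?e w | w. \<not> is_square (area ?e w)}" using g by blast
  qed
  finally show ?thesis using 1 by (simp add: A_odd_def cls_def)
qed

section \<open>Conjugate classes and the projective line\<close>

lemma conj_transporter:
  assumes "h \<in> carrier SL2"
  shows "(inv\<^bsub>SL2\<^esub> h <#\<^bsub>SL2\<^esub> transporter v w) #>\<^bsub>SL2\<^esub> h = transporter (adj h *v v) (adj h *v w)"
  using assms by (simp add: transporter_l_coset transporter_r_coset)

text \<open>Conjugation moves the source and the target of a pair by the same matrix of determinant
  1, so areas are preserved and the label moves along.\<close>

lemma conj_cls:
  assumes "h \<in> carrier SL2" "u \<noteq> 0"
  shows "{(inv\<^bsub>SL2\<^esub> h <#\<^bsub>SL2\<^esub> X) #>\<^bsub>SL2\<^esub> h | X. X \<in> cls u} = cls (adj h *v u)"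
proof (intro equalityI subsetI)
  fix Y assume "Y \<in> {(inv\<^bsub>SL2\<^esub> h <#\<^bsub>SL2\<^esub> X) #>\<^bsub>SL2\<^esub> h | X. X \<in> cls u}"
  then obtain X where X: "X \<in> cls u" "Y = (inv\<^bsub>SL2\<^esub> h <#\<^bsub>SL2\<^esub> X) #>\<^bsub>SL2\<^esub> h" by blast
  then obtain v w where "X = transporter v w" "v \<noteq> 0" "w \<noteq> 0" using assms by (blast elim: clsE)
  then show "Y \<in> cls (adj h *v u)"
    using X assms by (simp add: conj_transporter transporter_in_cls_iff del: inv_SL2)
next
  fix Y assume Y: "Y \<in> cls (adj h *v u)"
  then obtain v w where vw: "Y = transporter v w" "v \<noteq> 0" "w \<noteq> 0" using assms clsE[OF Y] by auto
  have "transporter (h *v v) (h *v w) \<in> cls u"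
    using vw Y assms area_SL2[of h v "adj h *v u"] area_SL2[of h w "adj h *v u"] area_SL2[of h v w]
    by (simp add: transporter_in_cls_iff del: area_SL2)
  moreover have "(inv\<^bsub>SL2\<^esub> h <#\<^bsub>SL2\<^esub> transporter (h *v v) (h *v w)) #>\<^bsub>SL2\<^esub> h = Y"
    using assms vw by (simp add: conj_transporter del: inv_SL2)
  ultimately show "Y \<in> {(inv\<^bsub>SL2\<^esub> h <#\<^bsub>SL2\<^esub> X) #>\<^bsub>SL2\<^esub> h | X. X \<in> cls u}" by blast
qed

text \<open>The labels of the conjugates of \<open>A_odd\<close> form the orbit of the first basis
  vector under \<open>SL2\<close>, which consists of all nonzero vectors.\<close>

lemma pi_odd_eq: "pi_odd = {cls u | u :: 'a::field ^ 2. u \<noteq> 0}"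
proof -
  have e: "V2 1 0 \<noteq> (0 :: 'a ^ 2)" by (simp add: M2_simps)
  have "pi_odd = {cls (adj h *v V2 1 0 :: 'a ^ 2) | h. h \<in> carrier SL2}"
    unfolding pi_odd_def A_odd_eq using conj_cls[OF _ e] by blast
  also have "\<dots> = {cls u | u :: 'a ^ 2. u \<noteq> 0}"
  proof -
    have "\<exists>h \<in> carrier SL2. u = adj h *v V2 1 0" if u: "u \<noteq> 0" for u :: "'a ^ 2"
    proof -
      obtain h where "h \<in> carrier SL2" "h *v u = V2 1 0"
        using SL2_transitive[OF u e] by (auto simp: transporter_def)
      then show ?thesis by (metis adj_cancel(5))
    qed
    moreover have "adj h *v V2 1 0 \<noteq> (0 :: 'a ^ 2)" if "h \<in> carrier SL2" for h
      using that e by simp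
    ultimately have "(\<lambda>h. adj h *v V2 1 0) ` carrier SL2 = {u :: 'a ^ 2. u \<noteq> 0}"
      by (intro equalityI subsetI) auto
    then have "cls ` (\<lambda>h. adj h *v V2 1 0) ` carrier SL2 = cls ` {u :: 'a ^ 2. u \<noteq> 0}"
      by (rule arg_cong)
    then show ?thesis by (simp add: setcompr_eq_image image_image)
  qed
  finally show ?thesis .
qed

section \<open>The parallelism axioms: size, disjointness and number of the classes\<close>

lemma card_cls:
  fixes u :: "'a::{field,finite} ^ 2"
  assumes u: "u \<noteq> 0"
  shows "card (cls u) = CARD('a) ^ 2 - 1"
proof -
  \<comment> \<open>The sign gives \<open>area u (- v) = area v u\<close>, so each nonzero
    \<open>v\<close> contributes one coset to the class, whether or not -1 is a square.\<close>
  define F where "F = (\<lambda>v. if is_square (area v u) then transporter v u else transporter u (- v))"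
  have nz: "v \<noteq> 0" if "\<not> is_square (area v u)" for v using that by (auto simp: area_def)
  have "bij_betw F {v. v \<noteq> 0} (cls u)"
    unfolding bij_betw_def
  proof
    show "inj_on F {v. v \<noteq> 0}"
    proof (rule inj_onI)
      fix v w assume *: "v \<in> {v. v \<noteq> 0}" "w \<in> {v. v \<noteq> 0}" "F v = F w"
      have r1: "r = 1" if "u = r *s u" for r
        using that u vector_mul_rcancel[of 1 u r] by simp
      \<comment> \<open>Equality would make \<open>- w\<close> a multiple of \<open>u\<close>, so
        that \<open>area w u\<close> would be 0, which counts as a square.\<close>
      have ne: "transporter v u \<noteq> transporter u (- w)" if vw: "\<not> is_square (area w u)" "v \<noteq> 0" for v w
      proof
        assume "transporter v u = transporter u (- w)"
        then obtain r where "- w = r *s u" using u vw by (auto simp: transporter_eq_iff)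
        then have "area (- w) u = 0" by simp
        then show False using vw by simp
      qed
      consider "is_square (area v u)" "is_square (area w u)" | "is_square (area v u)" "\<not> is_square (area w u)"
        | "\<not> is_square (area v u)" "is_square (area w u)" | "\<not> is_square (area v u)" "\<not> is_square (area w u)"
        by blast
      then show "v = w"
      proof cases
        case 1
        then obtain r where "w = r *s v" "u = r *s u" using * u by (auto simp: F_def transporter_eq_iff)
        then show ?thesis using r1[of r] by simp
      next
        case 4
        then obtain r where "- w = r *s - v" "u = r *s u" using * u by (auto simp: F_def transporter_eq_iff)
        then show ?thesis using r1[of r] by simp
      qed (use * ne[of w v] ne[of v w] in \<open>auto simp: F_def\<close>)
    qed
    show "F ` {v. v \<noteq> 0} = cls u"
    proof (intro equalityI subsetI)
      fix X assume "X \<in> F ` {v. v \<noteq> 0}"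
      then show "X \<in> cls u" by (auto simp: F_def cls_def area_commute[of u])
    next
      fix X assume "X \<in> cls u"
      then consider v where "v \<noteq> 0" "is_square (area v u)" "X = transporter v u"
        | w where "\<not> is_square (area u w)" "X = transporter u w"
        by (auto simp: cls_def)
      then show "X \<in> F ` {v. v \<noteq> 0}"
      proof cases
        case (1 v) then show ?thesis by (auto simp: F_def intro!: image_eqI[of _ _ v])
      next
        case (2 w) then show ?thesis using nz[of "- w"]
          by (intro image_eqI[of _ _ "- w"]) (auto simp: F_def area_commute[of u])
      qed
    qed
  qed
  then show ?thesis by (simp add: bij_betw_same_card[symmetric] card_nonzero_vectors)
qed

lemma disjoint_cls: "disjoint (cls u)"
proof -
  \<comment> \<open>A common element \<open>g\<close> satisfies \<open>g *v v = u\<close> and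
    \<open>g *v u = w\<close>; invariance of the area gives \<open>area u w = area v u\<close>, a
    nonsquare equal to a square.\<close>
  have mixed: False if "\<not> is_square (area u w)" "is_square (area v u)" "g \<in> transporter v u" "g \<in> transporter u w" for g v w
    using that by (auto simp: transporter_def)
  have left: "v = v'" if g: "g \<in> transporter v u" "g \<in> transporter v' u" for g v v'
  proof -
    have "g \<in> carrier SL2" using g(1) by (simp add: transporter_def)
    moreover have "adj g *v (g *v v) = adj g *v (g *v v')" using g by (simp add: transporter_def)
    ultimately show ?thesis by simp
  qed
  have right: "w = w'" if "g \<in> transporter u w" "g \<in> transporter u w'" for g w w'
    using that by (simp add: transporter_def)
  have "X = Y" if XY: "X \<in> cls u" "Y \<in> cls u" and g: "g \<in> X" "g \<in> Y" for X Y g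
  proof -
    consider v v' where "X = transporter v u" "Y = transporter v' u"
      | v w where "is_square (area v u)" "X = transporter v u" "\<not> is_square (area u w)" "Y = transporter u w"
      | v w where "is_square (area v u)" "Y = transporter v u" "\<not> is_square (area u w)" "X = transporter u w"
      | w w' where "X = transporter u w" "Y = transporter u w'"
      using XY by (auto simp: cls_def)
    then show ?thesis
    proof cases
      case (1 v v') then show ?thesis using left[of g v v'] g by simp
    next
      case (2 v w) then show ?thesis using mixed[of w v g] g by simp
    next
      case (3 v w) then show ?thesis using mixed[of w v g] g by simp
    next
      case (4 w w') then show ?thesis using right[of g w w'] g by simp
    qed
  qed
  then show ?thesis by (intro disjointI) auto
qed

text \<open>Every point of the projective line is represented by exactly one of
  \<open>V2 1 0\<close> and the vectors \<open>V2 x 1\<close>.\<close>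

lemma card_pi_odd: "card (pi_odd :: ('a::{field,finite} ^ 2 ^ 2) set set set) = CARD('a) + 1"
proof -
  let ?f = "\<lambda>x :: 'a. cls (V2 x 1)"
  have nz: "V2 1 0 \<noteq> (0 :: 'a ^ 2)" "V2 x 1 \<noteq> (0 :: 'a ^ 2)" for x by (simp_all add: M2_simps)
  have "pi_odd = insert (cls (V2 1 0)) (range ?f)"
  proof (intro equalityI subsetI)
    fix C :: "('a ^ 2 ^ 2) set set" assume "C \<in> pi_odd"
    then obtain u where u: "u \<noteq> 0" "C = cls u" by (auto simp: pi_odd_eq)
    obtain a b where ab: "u = V2 a b" by (cases u)
    show "C \<in> insert (cls (V2 1 0)) (range ?f)"
    proof (cases "b = 0")
      case True
      then have "cls u = cls (V2 1 0)" using u nz by (simp add: cls_eq_iff ab M2_simps(9))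
      then show ?thesis using u by simp
    next
      case False
      then have "cls u = ?f (a / b)" using u nz by (simp add: cls_eq_iff ab M2_simps(9))
      then show ?thesis using u by blast
    qed
  qed (use nz in \<open>auto simp: pi_odd_eq\<close>)
  moreover have "inj ?f"
  proof (rule injI)
    show "x = y" if "?f x = ?f y" for x y using that nz by (simp add: cls_eq_iff M2_simps(9))
  qed
  moreover have "cls (V2 1 0) \<notin> range ?f" using nz by (auto simp: cls_eq_iff M2_simps(9))
  ultimately show ?thesis using card_insert_disjoint[of "range ?f" "cls (V2 1 0)"]
    by (simp only: card_image finite_imageI[OF finite] Suc_eq_plus1 simp_thms)
qed

lemma parallelism_pi_odd:
  assumes "prime p" "e \<ge> 1" "CARD('a) = p ^ e"
  shows "parallelism p (pi_odd :: ('a::{field,finite} ^ 2 ^ 2) set set set)"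
proof -
  have "partition_on {transporter v w | v w :: 'a ^ 2. v \<noteq> 0 \<and> w \<noteq> 0} pi_odd"
  proof (rule partition_onI)
    have ex: "\<exists>u. u \<noteq> 0 \<and> transporter v w \<in> cls u" if "v \<noteq> 0" "w \<noteq> 0" for v w :: "'a ^ 2"
      using that transporter_in_cls_iff[of w v w] transporter_in_cls_iff[of v v w]
      by (cases "is_square (area v w)") auto
    show "\<Union>pi_odd = {transporter v w | v w :: 'a ^ 2. v \<noteq> 0 \<and> w \<noteq> 0}"
    proof (intro equalityI subsetI)
      fix X :: "('a ^ 2 ^ 2) set" assume "X \<in> \<Union>pi_odd"
      then obtain u :: "'a ^ 2" where "u \<noteq> 0" "X \<in> cls u" by (auto simp: pi_odd_eq)
      then obtain v w where "X = transporter v w" "v \<noteq> 0" "w \<noteq> 0" by (elim clsE)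
      then show "X \<in> {transporter v w | v w. v \<noteq> 0 \<and> w \<noteq> 0}" by auto
    next
      fix X :: "('a ^ 2 ^ 2) set" assume "X \<in> {transporter v w | v w. v \<noteq> 0 \<and> w \<noteq> 0}"
      then obtain v w where vw: "X = transporter v w" "v \<noteq> 0" "w \<noteq> 0" by auto
      then obtain u where "u \<noteq> 0" "X \<in> cls u" using ex[OF vw(2,3)] by auto
      then show "X \<in> \<Union>pi_odd" by (auto simp: pi_odd_eq)
    qed
    show "disjnt C D" if CD: "C \<in> pi_odd" "D \<in> pi_odd" "C \<noteq> D" for C D :: "('a ^ 2 ^ 2) set set"
    proof -
      obtain u v where "C = cls u" "D = cls v" "u \<noteq> 0" "v \<noteq> 0"
        using CD(1,2) by (auto simp: pi_odd_eq)
      then show ?thesis using cls_inter[of u v] CD(3) unfolding disjnt_iff by metis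
    qed
    show "{} \<notin> (pi_odd :: ('a ^ 2 ^ 2) set set set)"
    proof
      assume "{} \<in> (pi_odd :: ('a ^ 2 ^ 2) set set set)"
      then obtain u :: "'a ^ 2" where "u \<noteq> 0" "cls u = {}" by (auto simp: pi_odd_eq)
      then show False using transporter_in_cls_iff[of u u u] by simp
    qed
  qed
  then show ?thesis
    using card_pi_odd card_cls disjoint_cls
    by (auto simp: parallelism_def sylow_cosets_SL2[OF assms] pi_odd_eq)
qed

section \<open>Automorphisms of SL2\<close>

lemma SL2_auto_mult:
  assumes "\<phi> \<in> auto SL2" "g \<in> carrier SL2" "h \<in> carrier SL2"
  shows "\<phi> (g ** h) = \<phi> g ** \<phi> h"
  using assms by (auto simp: auto_def hom_def)

lemma SL2_auto_closed [simp]: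
  assumes "\<phi> \<in> auto SL2" "g \<in> carrier SL2"
  shows "\<phi> g \<in> carrier SL2"
  using assms by (auto simp: auto_def hom_def)

lemma auto_inj_on: "\<phi> \<in> auto G \<Longrightarrow> inj_on \<phi> (carrier G)"
  by (auto simp: auto_def Bij_def bij_betw_def)

lemma (in group) auto_subgroup_image:
  assumes "\<phi> \<in> auto G" "subgroup H G"
  shows "subgroup (\<phi> ` H) G"
proof -
  interpret group_hom G G \<phi>
    using assms by (intro group_hom.intro group_hom_axioms.intro is_group) (auto simp: auto_def)
  show ?thesis using assms(2) by (rule subgroup_img_is_subgroup)
qed

section \<open>Root subgroups and homomorphisms that preserve them\<close>

definition "U x = M2 1 x 0 (1 :: 'a::field)"
definition "L x = M2 1 0 x (1 :: 'a::field)"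

lemma UL_SL2 [simp]: "U x \<in> carrier SL2" "L x \<in> carrier SL2"
  by (simp_all add: U_def L_def carrier_SL2 M2_simps)

lemma UL_mult: "U x ** U y = U (x + y)" "L x ** L y = L (x + y)"
  by (simp_all add: U_def L_def M2_mult)

lemma UL_inject [simp]: "U x = U y \<longleftrightarrow> x = y" "L x = L y \<longleftrightarrow> x = y"
  by (simp_all add: U_def L_def)

text \<open>The root subgroups are Sylow subgroups, namely the stabilizers of the standard basis
  vectors. This allows their images under an automorphism to be located.\<close>

lemma stabilizer_e1: "g \<in> transporter (V2 1 0) (V2 1 0) \<longleftrightarrow> (\<exists>x. g = U x)"
  by (cases g rule: M2_cases) (auto simp: transporter_def carrier_SL2 M2_simps U_def)

lemma stabilizer_e2: "g \<in> transporter (V2 0 1) (V2 0 1) \<longleftrightarrow> (\<exists>x. g = L x)"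
  by (cases g rule: M2_cases) (auto simp: transporter_def carrier_SL2 M2_simps L_def)

text \<open>If the lower left entry \<open>c\<close> is nonzero, \<open>g\<close> is a product with
  \<open>L c\<close> between two upper factors. Otherwise the upper left entry is nonzero, and
  multiplying by \<open>L 1\<close> adds it to the lower left entry; undoing this costs the extra
  factor on the left.\<close>

lemma SL2_decomposition:
  fixes g :: "'a::field ^ 2 ^ 2"
  assumes "g \<in> carrier SL2"
  shows "\<exists>w x y z. g = L w ** (U x ** (L y ** U z))"
proof -
  have *: "\<exists>x y z. g = U x ** (L y ** U z)" if g: "g \<in> carrier SL2" "g $ 2 $ 1 \<noteq> 0" for g :: "'a ^ 2 ^ 2"
  proof -
    obtain a b c d where abcd: "g = M2 a b c d" by (rule M2_cases)
    have c: "c \<noteq> 0" and det: "a * d - b * c = 1" using g by (auto simp: abcd carrier_SL2 M2_simps)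
    have "b = (a * d - 1) / c" using c det by (simp add: field_simps)
    moreover have "U ((a - 1) / c) ** (L c ** U ((d - 1) / c)) = M2 a ((a * d - 1) / c) c d"
      using c by (simp add: U_def L_def M2_mult field_simps)
    ultimately show ?thesis unfolding abcd by metis
  qed
  show ?thesis
  proof (cases "g $ 2 $ 1 = 0")
    case False
    then obtain x y z where "g = U x ** (L y ** U z)" using * assms by blast
    moreover have "L 0 = (mat 1 :: 'a ^ 2 ^ 2)" by (simp add: L_def M2_simps)
    ultimately have "g = L 0 ** (U x ** (L y ** U z))" by simp
    then show ?thesis by blast
  next
    case True
    obtain a b c d where abcd: "g = M2 a b c d" by (rule M2_cases)
    have "a \<noteq> 0" "c = 0" using True assms by (auto simp: abcd carrier_SL2 M2_simps)
    then have "(L 1 ** g) $ 2 $ 1 \<noteq> 0" by (simp add: abcd L_def M2_simps)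
    moreover have "L 1 ** g \<in> carrier SL2" using assms by simp
    ultimately obtain x y z where "L 1 ** g = U x ** (L y ** U z)" using * by blast
    moreover have "L (- 1) ** (L 1 ** g) = g"
      by (simp add: matrix_mul_assoc UL_mult) (simp add: L_def mat_1_M2[symmetric])
    ultimately have "g = L (- 1) ** (U x ** (L y ** U z))" by metis
    then show ?thesis by blast
  qed
qed

text \<open>For nonzero \<open>x\<close> this is a representative of the Weyl element. Writing it as
  a product of root elements makes its image under a homomorphism computable.\<close>

definition W :: "'a \<Rightarrow> 'a::field ^ 2 ^ 2" where
  "W x = U x ** (L (- 1 / x) ** U x)"

lemma W_eq: "x \<noteq> 0 \<Longrightarrow> W x = M2 0 x (- 1 / x) 0"
  by (simp add: W_def U_def L_def M2_mult)

lemma map_matrix_mult: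
  assumes "\<And>x y. \<tau> (x + y) = \<tau> x + \<tau> y" "\<And>x y. \<tau> (x * y) = \<tau> x * \<tau> y"
  shows "map_matrix \<tau> (g ** h) = map_matrix \<tau> (g :: 'a::field ^ 2 ^ 2) ** map_matrix \<tau> (h :: 'a ^ 2 ^ 2)"
  by (cases g rule: M2_cases; cases h rule: M2_cases) (simp add: M2_simps assms)

text \<open>The relation \<open>W x ** U 1 = L (- 1 / x\<^sup>2) ** W x\<close> forces \<open>\<psi> (W x) = W (f x)\<close>;
  multiplicativity of \<open>f\<close> then comes from the torus elements \<open>W x ** W (- 1)\<close>.\<close>

lemma normalized_hom_is_field_automorphism:
  fixes \<psi> :: "'a::{field,finite} ^ 2 ^ 2 \<Rightarrow> 'a ^ 2 ^ 2"
  assumes mult: "\<And>g h. g \<in> carrier SL2 \<Longrightarrow> h \<in> carrier SL2 \<Longrightarrow> \<psi> (g ** h) = \<psi> g ** \<psi> h"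
    and inj: "inj_on \<psi> (carrier SL2)"
    and U: "\<And>x. \<psi> (U x) = U (f x)" and L: "\<And>x. \<psi> (L x) = L (f' x)" and f1: "f 1 = 1"
  shows "f \<in> field_automorphisms" "\<And>g. g \<in> carrier SL2 \<Longrightarrow> \<psi> g = map_matrix f g"
proof -
  have add: "f (x + y) = f x + f y" "f' (x + y) = f' x + f' y" for x y
    using mult[of "U x" "U y"] mult[of "L x" "L y"] by (simp_all add: UL_mult U L)
  have f0: "f 0 = 0" "f' 0 = 0" using add(1)[of 0 0] add(2)[of 0 0] by (metis add_0_right add_left_cancel)+
  have neg: "f (- x) = - f x" for x using add(1)[of x "- x"] by (simp add: f0 eq_neg_iff_add_eq_0 add.commute)
  have inj_f: "inj f"
  proof (rule injI)
    fix x y assume "f x = f y"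
    then have "\<psi> (U x) = \<psi> (U y)" by (simp add: U)
    then have "U x = U y" using inj_onD[OF inj] UL_SL2 by metis
    then show "x = y" by simp
  qed
  have f_nz: "f x \<noteq> 0" if "x \<noteq> 0" for x using injD[OF inj_f, of x 0] that f0 by auto
  have W_SL2: "W x \<in> carrier SL2" if "x \<noteq> 0" for x :: 'a
    using that by (simp add: W_eq carrier_SL2 M2_simps)
  have fW: "\<psi> (W x) = W (f x)" and ff': "f x * f' (- 1 / x) = - 1" if x: "x \<noteq> 0" for x
  proof -
    define b where "b = f' (- 1 / x)"
    have \<psi>W: "\<psi> (W x) = U (f x) ** (L b ** U (f x))"
      by (simp add: W_def mult U L b_def)
    have "W x ** U 1 = L (- 1 / x ^ 2) ** W x"
      using x by (simp add: W_eq U_def L_def M2_mult power2_eq_square)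
    then have "\<psi> (W x) ** U 1 = L (f' (- 1 / x ^ 2)) ** \<psi> (W x)"
      using mult[OF W_SL2[OF x] UL_SL2(1)[of 1]] mult[OF UL_SL2(2) W_SL2[OF x]] by (simp add: U L f1)
    \<comment> \<open>Left multiplication by an \<open>L\<close> leaves the first row unchanged, so
      the upper right entries differ only by the upper left entry \<open>1 + f x * b\<close> of
      \<open>\<psi> (W x)\<close>, which therefore vanishes.\<close>
    then have "(\<psi> (W x) ** U 1) $ 1 $ 2 = (L (f' (- 1 / x ^ 2)) ** \<psi> (W x)) $ 1 $ 2" by simp
    then have "1 + f x * b = 0" by (simp add: \<psi>W U_def L_def M2_mult)
    then show *: "f x * f' (- 1 / x) = - 1" unfolding b_def by (simp add: eq_neg_iff_add_eq_0 add.commute)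
    then have "b = - 1 / f x" using f_nz[OF x] by (simp add: b_def field_simps)
    then show "\<psi> (W x) = W (f x)" unfolding \<psi>W by (simp add: W_def)
  qed
  have f_mult: "f (x * y) = f x * f y" for x y
  proof (cases "x = 0 \<or> y = 0")
    case False
    then have xy: "x \<noteq> 0" "y \<noteq> 0" "x * y \<noteq> 0" by auto
    define H :: "'a \<Rightarrow> 'a ^ 2 ^ 2" where "H = (\<lambda>x. W x ** W (- 1))"
    have H: "H x = M2 x 0 0 (1 / x)" if "x \<noteq> 0" for x using that by (simp add: H_def W_eq M2_mult)
    have H_SL2: "H x \<in> carrier SL2" if "x \<noteq> 0" for x using that by (simp add: H carrier_SL2 M2_simps)
    have \<psi>H: "\<psi> (H x) = H (f x)" if "x \<noteq> 0" for x
      using that fW[of "- 1"] by (simp add: H_def mult W_SL2 fW neg f1)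
    have "H (x * y) = H x ** H y" using xy by (simp add: H M2_mult)
    then have "H (f (x * y)) = H (f x) ** H (f y)"
      using xy \<psi>H mult[OF H_SL2 H_SL2] by metis
    then show ?thesis using xy f_nz by (simp add: H M2_mult)
  qed (auto simp: f0)
  have f'_eq: "f' x = f x" for x
  proof (cases "x = 0")
    case False
    have "f (- 1 / x) * f x = - 1" using f_mult[of "- 1 / x" x] False by (simp add: neg f1)
    \<comment> \<open>The map \<open>x \<mapsto> - 1 / x\<close> is an involution, so evaluating
      \<open>ff'\<close> at \<open>- 1 / x\<close> produces \<open>f' x\<close>.\<close>
    moreover have "f (- 1 / x) * f' x = - 1" using ff'[of "- 1 / x"] False by simp
    ultimately have "f (- 1 / x) * f' x = f (- 1 / x) * f x" by simp
    then show ?thesis using f_nz[of "- 1 / x"] False by simp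
  qed (simp add: f0)
  have "surj f" using finite_UNIV_inj_surj[OF finite inj_f] .
  then show "f \<in> field_automorphisms"
    using inj_f add(1) f_mult f1 by (simp add: field_automorphisms_def bij_def)
  fix g :: "'a ^ 2 ^ 2" assume "g \<in> carrier SL2"
  then obtain w x y z where g: "g = L w ** (U x ** (L y ** U z))" using SL2_decomposition by blast
  have "map_matrix f (U x) = U (f x)" "map_matrix f (L x) = L (f x)" for x
    by (simp_all add: U_def L_def map_matrix_M2 f0 f1)
  then show "\<psi> g = map_matrix f g"
    by (simp add: g mult U L f'_eq map_matrix_mult[OF add(1) f_mult])
qed

section \<open>Arbitrary automorphisms, normalized by a change of basis\<close>

lemma SL2_conj:
  fixes b :: "'a::field ^ 2 ^ 2"
  assumes "det b \<noteq> 0"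
  shows "matrix_inv b ** b = mat 1" "b ** matrix_inv b = mat 1" "det (matrix_inv b) = 1 / det b"
proof -
  have "invertible b" using assms by (simp add: invertible_det_nz)
  then have "\<exists>b'. b ** b' = mat 1 \<and> b' ** b = mat 1" by (simp add: invertible_def)
  from someI_ex[OF this] show *: "matrix_inv b ** b = mat 1" "b ** matrix_inv b = mat 1"
    by (simp_all add: matrix_inv_def)
  then have "det (matrix_inv b) * det b = 1" by (metis det_mul det_I)
  then show "det (matrix_inv b) = 1 / det b" using assms by (simp add: field_simps)
qed

text \<open>The images of the two root subgroups are stabilizers of two independent vectors. Passing
  to a suitably scaled basis of such vectors gives a homomorphism that preserves both root subgroups
  and fixes \<open>U 1\<close>, hence acts by a field automorphism on the entries.\<close>

theorem SL2_automorphism: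
  fixes \<phi> :: "'a::{field,finite} ^ 2 ^ 2 \<Rightarrow> 'a ^ 2 ^ 2"
  assumes p: "prime p" "e \<ge> 1" "CARD('a) = p ^ e" and \<phi>: "\<phi> \<in> auto SL2"
  obtains b \<tau> where "det b \<noteq> 0" "\<tau> \<in> field_automorphisms"
    "\<And>g. g \<in> carrier SL2 \<Longrightarrow> \<phi> g ** b = b ** map_matrix \<tau> g"
proof -
  have img: "\<exists>v. v \<noteq> 0 \<and> \<phi> ` transporter u u = transporter v v" if u: "u \<noteq> 0" for u
  proof -
    have "transporter u u \<in> sylow_subgroups p SL2"
      using u by (auto simp: sylow_subgroups_SL2[OF p])
    moreover have "card (\<phi> ` transporter u u) = card (transporter u u)"
      by (intro card_image inj_on_subset[OF auto_inj_on[OF \<phi>]] transporter_subset)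
    ultimately have "\<phi> ` transporter u u \<in> sylow_subgroups p SL2"
      using group.auto_subgroup_image[OF group_SL2 \<phi>] by (simp add: sylow_subgroups_def)
    then show ?thesis by (auto simp: sylow_subgroups_SL2[OF p])
  qed
  let ?e1 = "V2 1 0 :: 'a ^ 2" and ?e2 = "V2 0 1 :: 'a ^ 2"
  have e: "?e1 \<noteq> 0" "?e2 \<noteq> 0" by (simp_all add: M2_simps)
  obtain v1 where v1: "v1 \<noteq> 0" "\<phi> ` transporter ?e1 ?e1 = transporter v1 v1" using img[OF e(1)] by blast
  obtain v2 where v2: "v2 \<noteq> 0" "\<phi> ` transporter ?e2 ?e2 = transporter v2 v2" using img[OF e(2)] by blast
  have indep: "area v1 v2 \<noteq> 0"
  proof
    assume "area v1 v2 = 0"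
    then obtain r where "r \<noteq> 0" "v2 = r *s v1" using area_eq_0D v1 v2 by metis
    then have "transporter v1 v1 = transporter v2 v2" using v1 v2 by (auto simp: transporter_eq_iff)
    then have "\<phi> ` transporter ?e1 ?e1 = \<phi> ` transporter ?e2 ?e2" by (simp only: v1 v2)
    then have "transporter ?e1 ?e1 = transporter ?e2 ?e2"
      using inj_on_image_eq_iff[OF auto_inj_on[OF \<phi>] transporter_subset transporter_subset] by metis
    then show False using e by (auto simp: transporter_eq_iff M2_simps)
  qed
  have U_fix: "\<phi> (U x) *v v1 = v1" for x
    using v1(2) stabilizer_e1[of "U x"] unfolding transporter_def by blast
  have L_fix: "\<phi> (L x) *v v2 = v2" for x
    using v2(2) stabilizer_e2[of "L x"] unfolding transporter_def by blast
  \<comment> \<open>Since \<open>\<phi> (U 1)\<close> fixes \<open>v1\<close> and preserves areas,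
    it moves \<open>v2\<close> by a multiple of \<open>v1\<close>.\<close>
  have "area (\<phi> (U 1) *v v1) (\<phi> (U 1) *v v2) = area v1 v2" by (simp add: \<phi>)
  then have "area v1 (\<phi> (U 1) *v v2 - v2) = 0" by (simp add: U_fix area_def algebra_simps)
  then obtain s where "\<phi> (U 1) *v v2 - v2 = s *s v1" using area_eq_0_iff[OF v1(1)] by blast
  then have s: "\<phi> (U 1) *v v2 = v2 + s *s v1" by (simp add: algebra_simps)
  have "s \<noteq> 0"
  proof
    assume "s = 0"
    then have "\<phi> (U 1) \<in> transporter v2 v2" using s \<phi> by (simp add: transporter_def)
    then obtain g where g: "g \<in> transporter ?e2 ?e2" "\<phi> (U 1) = \<phi> g" using v2(2) by blast
    then obtain y where "g = L y" using stabilizer_e2 by blast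
    then have "U 1 = (L y :: 'a ^ 2 ^ 2)" using inj_onD[OF auto_inj_on[OF \<phi>] g(2)] by simp
    then show False by (simp add: U_def L_def)
  qed
  \<comment> \<open>Scaling the first column by \<open>s\<close> is what turns the conjugate of
    \<open>\<phi> (U 1)\<close> into \<open>U 1\<close> itself.\<close>
  define b where "b = M2 (s * v1 $ 1) (v2 $ 1) (s * v1 $ 2) (v2 $ 2)"
  have b: "b *v ?e1 = s *s v1" "b *v ?e2 = v2"
    by (cases v1, cases v2, simp add: b_def M2_vec smult_V2)+
  have "det b = s * area v1 v2" by (simp add: b_def det_M2 area_def algebra_simps)
  then have det_b: "det b \<noteq> 0" using \<open>s \<noteq> 0\<close> indep by simp
  define b' where "b' = matrix_inv b"
  have b': "b' ** b = mat 1" "b ** b' = mat 1" "det b' = 1 / det b"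
    using SL2_conj[OF det_b] by (simp_all add: b'_def)
  have b'_cancel: "b' *v (b *v v) = v" "b ** (b' ** g) = g" for v g
    by (simp_all add: matrix_vector_mul_assoc matrix_mul_assoc b')
  define \<psi> where "\<psi> = (\<lambda>g. b' ** (\<phi> g ** b))"
  have det_\<psi>: "det (\<psi> g) = 1" if "g \<in> carrier SL2" for g
    using SL2_auto_closed[OF \<phi> that] det_b by (simp add: \<psi>_def det_mul b' carrier_SL2)
  have \<phi>_\<psi>: "\<phi> g ** b = b ** \<psi> g" for g by (simp add: \<psi>_def b'_cancel)
  have \<psi>_vec: "\<psi> g *v v = b' *v (\<phi> g *v (b *v v))" for g v
    by (simp add: \<psi>_def matrix_vector_mul_assoc matrix_mul_assoc)
  have \<psi>_mult: "\<psi> (g ** h) = \<psi> g ** \<psi> h" if "g \<in> carrier SL2" "h \<in> carrier SL2" for g h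
  proof -
    have "\<psi> g ** \<psi> h = b' ** (\<phi> g ** (b ** (b' ** (\<phi> h ** b))))"
      by (simp add: \<psi>_def flip: matrix_mul_assoc)
    then show ?thesis using SL2_auto_mult[OF \<phi> that] by (simp add: b'_cancel \<psi>_def flip: matrix_mul_assoc)
  qed
  have \<psi>_inj: "inj_on \<psi> (carrier SL2)"
  proof (rule inj_onI)
    fix g h assume gh: "g \<in> carrier SL2" "h \<in> carrier SL2" "\<psi> g = \<psi> h"
    then have "\<phi> g ** b = \<phi> h ** b" by (simp add: \<phi>_\<psi>)
    then have "\<phi> g ** b ** b' = \<phi> h ** b ** b'" by simp
    then have "\<phi> g = \<phi> h" by (simp add: b' flip: matrix_mul_assoc)
    then show "g = h" using gh inj_onD[OF auto_inj_on[OF \<phi>]] by metis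
  qed
  have "\<psi> (U x) *v ?e1 = ?e1" for x
    by (simp add: \<psi>_vec b vector_scalar_commute U_fix) (simp add: b'_cancel flip: b vector_scalar_commute)
  then have "\<exists>y. \<psi> (U x) = U y" for x
    unfolding stabilizer_e1[symmetric] by (simp add: transporter_def carrier_SL2 det_\<psi>[OF UL_SL2(1)])
  then obtain f where f: "\<psi> (U x) = U (f x)" for x by metis
  have "\<psi> (L x) *v ?e2 = ?e2" for x
    by (simp add: \<psi>_vec b L_fix) (simp add: b'_cancel flip: b)
  then have "\<exists>y. \<psi> (L x) = L y" for x
    unfolding stabilizer_e2[symmetric] by (simp add: transporter_def carrier_SL2 det_\<psi>[OF UL_SL2(2)])
  then obtain f' where f': "\<psi> (L x) = L (f' x)" for x by metis
  have "\<psi> (U 1) *v ?e2 = b' *v (b *v ?e2 + b *v ?e1)" by (simp add: \<psi>_vec b s)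
  also have "\<dots> = ?e2 + ?e1" by (simp add: matrix_vector_right_distrib b'_cancel)
  finally have "(U (f 1) *v ?e2) $ 1 = (?e2 + ?e1) $ 1" by (simp add: f)
  then have "f 1 = 1" by (simp add: U_def M2_vec)
  note normalized_hom_is_field_automorphism[OF \<psi>_mult \<psi>_inj f f' this]
  then show thesis using that[of b f] det_b \<phi>_\<psi> by metis
qed

section \<open>Squares in finite fields\<close>

text \<open>Adding 1 permutes the field, so summing all elements shows that \<open>CARD('a)\<close>
  is 0 in the field. If 1 = -1, then 2 = 0 and an odd number equals 1, a contradiction.\<close>

lemma odd_card_one_neq_minus_one:
  assumes "odd CARD('a::{field,finite})"
  shows "(1 :: 'a) \<noteq> - 1"
proof
  assume "(1 :: 'a) = - 1"
  then have two: "(2 :: 'a) = 0" by (metis add.right_inverse one_add_one)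
  have "bij (\<lambda>x :: 'a. x + 1)" by (rule bij_betw_byWitness[of _ "\<lambda>x. x - 1"]) auto
  from sum.reindex_bij_betw[OF this, of "\<lambda>x. x"]
  have "(\<Sum>x\<in>UNIV. x + 1) = (\<Sum>x\<in>UNIV. x :: 'a)" by simp
  then have "(of_nat CARD('a) :: 'a) = 0" by (simp add: sum.distrib)
  moreover obtain k where "CARD('a) = 2 * k + 1" using assms by (rule oddE)
  ultimately show False by (simp add: two)
qed

text \<open>Squaring identifies 1 and -1, so on a finite field it is not injective and hence not
  surjective.\<close>

lemma ex_nonsquare:
  assumes "odd CARD('a::{field,finite})"
  shows "\<exists>x :: 'a. \<not> is_square x"
proof (rule ccontr)
  assume "\<not> ?thesis"
  then have "surj (\<lambda>y :: 'a. y ^ 2)" unfolding is_square_def surj_def by auto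
  then have "inj (\<lambda>y :: 'a. y ^ 2)" by (rule finite_UNIV_surj_inj[OF finite])
  from injD[OF this, of 1 "- 1"] show False using odd_card_one_neq_minus_one[OF assms] by simp
qed

text \<open>Multiplication by \<open>x\<close> permutes the nonzero elements; compare their product
  before and after.\<close>

lemma finite_field_power_card:
  fixes x :: "'a::{field,finite}"
  assumes "x \<noteq> 0"
  shows "x ^ (CARD('a) - 1) = 1"
proof -
  let ?N = "UNIV - {0 :: 'a}"
  have "bij_betw (\<lambda>y. x * y) ?N ?N"
    by (rule bij_betw_byWitness[of _ "\<lambda>y. y / x"]) (use assms in auto)
  from prod.reindex_bij_betw[OF this, of "\<lambda>y. y"]
  have "x ^ card ?N * \<Prod>?N = \<Prod>?N" by (simp add: prod.distrib)
  moreover have "\<Prod>?N \<noteq> 0" by simp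
  ultimately show ?thesis by (simp add: card_Diff_singleton)
qed

text \<open>With \<open>4 * k\<close> nonzero elements, some nonzero \<open>x\<close> is not a root
  of the polynomial \<open>?p\<close> of degree \<open>2 * k\<close>. Then
  \<open>x ^ (2 * k)\<close> is a square root of 1 other than 1, so it is -1, and
  \<open>x ^ k\<close> is a square root of -1.\<close>

lemma minus_one_square:
  assumes q: "CARD('a::{field,finite}) mod 4 = 1"
  shows "is_square (- 1 :: 'a)"
proof -
  obtain k where k: "CARD('a) = 4 * k + 1" using q by (metis add.commute mod_mult_div_eq)
  have "card {0, 1 :: 'a} \<le> CARD('a)" by (rule card_mono) auto
  then have "k > 0" using k by simp
  have "\<exists>x :: 'a. x \<noteq> 0 \<and> x ^ (2 * k) \<noteq> 1"
  proof (rule ccontr)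
    assume *: "\<not> ?thesis"
    let ?p = "monom 1 (2 * k) - 1 :: 'a poly"
    have deg: "degree ?p = 2 * k"
      using \<open>k > 0\<close> by (subst diff_conv_add_uminus, subst degree_add_eq_left) (auto simp: degree_monom_eq)
    then have "?p \<noteq> 0" using \<open>k > 0\<close> by auto
    have "4 * k = card (UNIV - {0 :: 'a})" by (simp add: card_Diff_singleton k)
    also have "\<dots> \<le> card {x. poly ?p x = 0}"
      using * by (intro card_mono) (auto simp: poly_monom)
    also have "\<dots> \<le> 2 * k" using card_poly_roots_bound[OF \<open>?p \<noteq> 0\<close>] deg by simp
    finally show False using \<open>k > 0\<close> by simp
  qed
  then obtain x :: 'a where x: "x \<noteq> 0" "x ^ (2 * k) \<noteq> 1" by auto
  have "(x ^ (2 * k)) ^ 2 = 1" using finite_field_power_card[OF x(1)] k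
    by (simp flip: power_mult)
  then have "x ^ (2 * k) = - 1" using x(2) power2_eq_1_iff by blast
  then have "- 1 = (x ^ k) ^ 2" by (simp add: mult.commute flip: power_mult)
  then show ?thesis unfolding is_square_def by (rule exI)
qed

section \<open>The group of permutations\<close>

lemma carrier_PermSL2: "carrier PermSL2 = Bij (carrier SL2)"
  and mult_PermSL2: "\<alpha> \<otimes>\<^bsub>PermSL2\<^esub> \<beta> = compose (carrier SL2) \<beta> \<alpha>"
  and one_PermSL2: "\<one>\<^bsub>PermSL2\<^esub> = (\<lambda>g \<in> carrier SL2. g)"
  by (simp_all add: PermSL2_def)

lemma one_PermSL2_apply [simp]: "g \<in> carrier SL2 \<Longrightarrow> \<one>\<^bsub>PermSL2\<^esub> g = g"
  by (simp add: one_PermSL2)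

lemma mult_PermSL2_apply [simp]: "g \<in> carrier SL2 \<Longrightarrow> (\<alpha> \<otimes>\<^bsub>PermSL2\<^esub> \<beta>) g = \<beta> (\<alpha> g)"
  by (simp add: mult_PermSL2 compose_eq)

lemma group_PermSL2: "group (PermSL2 :: ('a::field ^ 2 ^ 2 \<Rightarrow> 'a ^ 2 ^ 2) monoid)"
proof (rule groupI)
  fix \<alpha> :: "'a ^ 2 ^ 2 \<Rightarrow> 'a ^ 2 ^ 2" assume \<alpha>: "\<alpha> \<in> carrier PermSL2"
  then have "\<alpha> ` carrier SL2 = carrier SL2" by (simp add: carrier_PermSL2 Bij_def bij_betw_def)
  then have "compose (carrier SL2) \<alpha> (restrict (inv_into (carrier SL2) \<alpha>) (carrier SL2)) = (\<lambda>g\<in>carrier SL2. g)"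
    by (rule compose_id_inv_into)
  then show "\<exists>\<beta>\<in>carrier PermSL2. \<beta> \<otimes>\<^bsub>PermSL2\<^esub> \<alpha> = \<one>\<^bsub>PermSL2\<^esub>"
    using restrict_inv_into_Bij[of \<alpha> "carrier SL2"] \<alpha> by (auto simp: carrier_PermSL2 mult_PermSL2 one_PermSL2)
qed (auto simp: carrier_PermSL2 mult_PermSL2 one_PermSL2 compose_Bij id_Bij
      Bij_imp_funcset compose_assoc
      Id_compose[OF Bij_imp_funcset Bij_imp_extensional] compose_Id[OF Bij_imp_funcset Bij_imp_extensional])

lemma PermSL2_ext:
  assumes "\<alpha> \<in> carrier PermSL2" "\<beta> \<in> carrier PermSL2" "\<And>g. g \<in> carrier SL2 \<Longrightarrow> \<alpha> g = \<beta> g"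
  shows "\<alpha> = \<beta>"
  by (rule extensionalityI[of _ "carrier SL2"]) (use assms in \<open>auto simp: carrier_PermSL2 Bij_def\<close>)

lemma PermSL2_I:
  assumes "\<And>g. g \<in> carrier SL2 \<Longrightarrow> f g \<in> carrier SL2 \<and> f' g \<in> carrier SL2 \<and> f' (f g) = g \<and> f (f' g) = g"
  shows "(\<lambda>g\<in>carrier SL2. f g) \<in> carrier PermSL2"
proof -
  have "bij_betw (\<lambda>g\<in>carrier SL2. f g) (carrier SL2) (carrier SL2)"
    by (rule bij_betw_byWitness[of _ f']) (use assms in auto)
  then show ?thesis by (simp add: carrier_PermSL2 Bij_def)
qed

lemma PermSL2_closed: "\<alpha> \<in> carrier PermSL2 \<Longrightarrow> g \<in> carrier SL2 \<Longrightarrow> \<alpha> g \<in> carrier SL2"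
  using Bij_imp_funcset by (auto simp: carrier_PermSL2)

lemma PermSL2_inj_on: "\<alpha> \<in> carrier PermSL2 \<Longrightarrow> inj_on \<alpha> (carrier SL2)"
  by (auto simp: carrier_PermSL2 Bij_def bij_betw_def)

lemma PermSL2_inv_apply:
  assumes "\<alpha> \<in> carrier PermSL2" "g \<in> carrier SL2"
  shows "(inv\<^bsub>PermSL2\<^esub> \<alpha>) (\<alpha> g) = g" "\<alpha> ((inv\<^bsub>PermSL2\<^esub> \<alpha>) g) = g" "(inv\<^bsub>PermSL2\<^esub> \<alpha>) g \<in> carrier SL2"
  using mult_PermSL2_apply[OF assms(2), of \<alpha> "inv\<^bsub>PermSL2\<^esub> \<alpha>"]
    mult_PermSL2_apply[OF assms(2), of "inv\<^bsub>PermSL2\<^esub> \<alpha>" \<alpha>]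
    group.r_inv[OF group_PermSL2 assms(1)] group.l_inv[OF group_PermSL2 assms(1)]
    PermSL2_closed[OF group.inv_closed[OF group_PermSL2 assms(1)] assms(2)] assms(2)
  by auto

section \<open>Affine maps of SL2\<close>

text \<open>Products of an automorphism and a translation are the bijections preserving the
  ternary operation \<open>x y\<^sup>-\<^sup>1 z\<close>, a description that is visibly closed under composition.\<close>

definition heap_maps :: "('a::field ^ 2 ^ 2 \<Rightarrow> 'a ^ 2 ^ 2) set" where
  "heap_maps = {\<sigma> \<in> carrier PermSL2. \<forall>x \<in> carrier SL2. \<forall>y \<in> carrier SL2. \<forall>z \<in> carrier SL2.
     \<sigma> (x ** adj y ** z) = \<sigma> x ** adj (\<sigma> y) ** \<sigma> z}"

lemma subgroup_heap_maps: "subgroup heap_maps PermSL2"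
proof (rule group.subgroupI[OF group_PermSL2])
  show "heap_maps \<subseteq> carrier PermSL2" by (auto simp: heap_maps_def)
  have "\<one>\<^bsub>PermSL2\<^esub> \<in> heap_maps"
    by (simp add: heap_maps_def group.is_monoid[OF group_PermSL2] monoid.one_closed)
  then show "heap_maps \<noteq> {}" by auto
next
  fix \<alpha> :: "'a ^ 2 ^ 2 \<Rightarrow> 'a ^ 2 ^ 2" assume \<alpha>: "\<alpha> \<in> heap_maps"
  let ?\<beta> = "inv\<^bsub>PermSL2\<^esub> \<alpha>"
  have \<alpha>': "\<alpha> \<in> carrier PermSL2" using \<alpha> by (simp add: heap_maps_def)
  have "?\<beta> (x ** adj y ** z) = ?\<beta> x ** adj (?\<beta> y) ** ?\<beta> z"
    if xyz: "x \<in> carrier SL2" "y \<in> carrier SL2" "z \<in> carrier SL2" for x y z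
  proof -
    have "\<alpha> (?\<beta> x ** adj (?\<beta> y) ** ?\<beta> z) = \<alpha> (?\<beta> x) ** adj (\<alpha> (?\<beta> y)) ** \<alpha> (?\<beta> z)"
      using \<alpha> xyz by (simp add: heap_maps_def PermSL2_inv_apply(3)[OF \<alpha>'])
    also have "\<dots> = x ** adj y ** z" using xyz by (simp add: PermSL2_inv_apply(2)[OF \<alpha>'])
    finally have "?\<beta> (x ** adj y ** z) = ?\<beta> (\<alpha> (?\<beta> x ** adj (?\<beta> y) ** ?\<beta> z))" by simp
    then show ?thesis using xyz by (simp add: PermSL2_inv_apply[OF \<alpha>'])
  qed
  then show "?\<beta> \<in> heap_maps"
    using group.inv_closed[OF group_PermSL2 \<alpha>'] by (simp add: heap_maps_def)
next
  fix \<alpha> \<beta> :: "'a ^ 2 ^ 2 \<Rightarrow> 'a ^ 2 ^ 2" assume "\<alpha> \<in> heap_maps" "\<beta> \<in> heap_maps"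
  then show "\<alpha> \<otimes>\<^bsub>PermSL2\<^esub> \<beta> \<in> heap_maps"
    by (simp add: heap_maps_def PermSL2_closed monoid.m_closed[OF group.is_monoid[OF group_PermSL2]])
qed

lemma auto_in_PermSL2: "\<phi> \<in> auto SL2 \<Longrightarrow> \<phi> \<in> carrier PermSL2"
  by (simp add: auto_def carrier_PermSL2)

lemma auto_one: "\<phi> \<in> auto SL2 \<Longrightarrow> \<phi> (mat 1) = (mat 1 :: 'a::field ^ 2 ^ 2)"
  using hom_one[of \<phi> SL2 SL2] group_SL2 by (auto simp: auto_def)

lemma auto_adj:
  assumes "\<phi> \<in> auto SL2" "g \<in> carrier SL2"
  shows "\<phi> (adj g) = adj (\<phi> (g :: 'a::field ^ 2 ^ 2))"
proof -
  interpret group_hom SL2 SL2 \<phi>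
    using assms by (intro group_hom.intro group_hom_axioms.intro group_SL2) (auto simp: auto_def)
  show ?thesis using hom_inv[of g] assms by simp
qed

lemma rho_in_PermSL2: "h \<in> carrier SL2 \<Longrightarrow> rho h \<in> carrier PermSL2"
  unfolding rho_def by (rule PermSL2_I[of _ "\<lambda>g. g ** adj h"]) simp

lemma subgroup_auto_trans: "subgroup auto_trans PermSL2"
  unfolding auto_trans_def right_translations_def
  by (rule group.generate_is_subgroup[OF group_PermSL2]) (auto simp: auto_in_PermSL2 rho_in_PermSL2)

lemma auto_trans_incl:
  "\<phi> \<in> auto SL2 \<Longrightarrow> \<phi> \<in> auto_trans" "h \<in> carrier SL2 \<Longrightarrow> rho h \<in> auto_trans"
  unfolding auto_trans_def right_translations_def by (auto intro: generate.incl)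

text \<open>It suffices to test generators. For a translation, \<open>h\<close> and its inverse
  cancel on either side of the inverted middle argument, leaving one factor \<open>h\<close> at the
  end.\<close>

lemma auto_trans_heap: "auto_trans \<subseteq> heap_maps"
  unfolding auto_trans_def
proof (rule group.generate_subgroup_incl[OF group_PermSL2 _ subgroup_heap_maps])
  have "rho h \<in> heap_maps" if h: "h \<in> carrier SL2" for h :: "'a ^ 2 ^ 2"
  proof -
    have "x ** adj y ** z ** h = x ** h ** adj (y ** h) ** (z ** h)"
      if "x \<in> carrier SL2" "y \<in> carrier SL2" "z \<in> carrier SL2" for x y z
    proof -
      have "adj (y ** h) = adj h ** adj y"
        by (cases y rule: M2_cases; cases h rule: M2_cases) (simp add: adj_def M2_mult algebra_simps)
      moreover have "x ** h ** (adj h ** adj y) ** (z ** h) = x ** (h ** (adj h ** (adj y ** (z ** h))))"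
        by (simp add: matrix_mul_assoc)
      ultimately show ?thesis using h by (simp add: matrix_mul_assoc[symmetric])
    qed
    then show ?thesis using rho_in_PermSL2[OF h] by (simp add: heap_maps_def) (simp add: rho_def)
  qed
  moreover have "\<phi> \<in> heap_maps" if "\<phi> \<in> auto SL2" for \<phi> :: "'a ^ 2 ^ 2 \<Rightarrow> 'a ^ 2 ^ 2"
    using that by (simp add: heap_maps_def auto_in_PermSL2 SL2_auto_mult auto_adj)
  ultimately show "auto SL2 \<union> right_translations \<subseteq> (heap_maps :: ('a ^ 2 ^ 2 \<Rightarrow> 'a ^ 2 ^ 2) set)"
    by (auto simp: right_translations_def)
qed

text \<open>The ternary identity with middle argument 1 expresses \<open>\<sigma> (x ** z)\<close>
  with the inverse of \<open>\<sigma> (mat 1)\<close> inserted between the two values; dividing by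
  \<open>\<sigma> (mat 1)\<close> on the right makes the map multiplicative.\<close>

lemma auto_trans_linear_part:
  assumes \<sigma>: "\<sigma> \<in> auto_trans"
  shows "(\<lambda>g \<in> carrier SL2. \<sigma> g ** adj (\<sigma> (mat 1))) \<in> auto SL2"
proof -
  have heap: "\<sigma> \<in> heap_maps" using \<sigma> auto_trans_heap by auto
  then have \<sigma>': "\<sigma> \<in> carrier PermSL2" by (simp add: heap_maps_def)
  have h: "\<sigma> (mat 1) \<in> carrier SL2" by (simp add: PermSL2_closed[OF \<sigma>'])
  let ?\<phi> = "\<lambda>g \<in> carrier SL2. \<sigma> g ** adj (\<sigma> (mat 1))"
  have "?\<phi> = \<sigma> \<otimes>\<^bsub>PermSL2\<^esub> rho (adj (\<sigma> (mat 1)))"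
    by (auto simp: mult_PermSL2 compose_def rho_def PermSL2_closed[OF \<sigma>'])
  then have "?\<phi> \<in> Bij (carrier SL2)"
    using monoid.m_closed[OF group.is_monoid[OF group_PermSL2] \<sigma>' rho_in_PermSL2[OF adj_closed[OF h]]]
    by (simp add: carrier_PermSL2)
  moreover have "\<sigma> (x ** z) = \<sigma> x ** adj (\<sigma> (mat 1)) ** \<sigma> z" if "x \<in> carrier SL2" "z \<in> carrier SL2" for x z
  proof -
    have "adj (mat 1) = (mat 1 :: 'a ^ 2 ^ 2)" by (simp add: adj_def M2_simps)
    moreover have "\<sigma> (x ** adj (mat 1) ** z) = \<sigma> x ** adj (\<sigma> (mat 1)) ** \<sigma> z"
      using heap that unfolding heap_maps_def by auto
    ultimately show ?thesis by simp
  qed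
  then have "?\<phi> \<in> hom SL2 SL2"
    using h by (auto simp: hom_def PermSL2_closed[OF \<sigma>'] matrix_mul_assoc)
  ultimately show ?thesis by (simp add: auto_def)
qed

section \<open>Action on the cosets\<close>

lemma field_automorphismsD:
  assumes "\<tau> \<in> field_automorphisms"
  shows "\<tau> (x + y) = \<tau> x + \<tau> y" "\<tau> (x * y) = \<tau> x * \<tau> y" "\<tau> 1 = 1" "\<tau> 0 = 0" "\<tau> (- x) = - \<tau> x"
    "inj \<tau>" "surj \<tau>"
proof -
  show add: "\<tau> (x + y) = \<tau> x + \<tau> y" for x y using assms by (simp add: field_automorphisms_def)
  show 0: "\<tau> 0 = 0" using add[of 0 0] by (metis add_0_right add_left_cancel)
  show "\<tau> (- x) = - \<tau> x" using add[of x "- x"] 0 by (simp add: eq_neg_iff_add_eq_0 add.commute)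
qed (use assms in \<open>auto simp: field_automorphisms_def bij_def\<close>)

lemma field_automorphism_eq_0_iff: "\<tau> \<in> field_automorphisms \<Longrightarrow> \<tau> x = 0 \<longleftrightarrow> x = 0"
  using field_automorphismsD(4,6) injD by metis

lemma field_automorphism_is_square:
  assumes "\<tau> \<in> field_automorphisms"
  shows "is_square (\<tau> x) \<longleftrightarrow> is_square x"
proof
  assume "is_square (\<tau> x)"
  then obtain y where y: "\<tau> x = y ^ 2" by (auto simp: is_square_def)
  obtain z where "y = \<tau> z" using field_automorphismsD(7)[OF assms] by (metis surjD)
  then have "\<tau> x = \<tau> (z ^ 2)" using y by (simp add: power2_eq_square field_automorphismsD[OF assms])
  then have "x = z ^ 2" using field_automorphismsD(6)[OF assms] by (simp add: inj_eq)
  then show "is_square x" by (auto simp: is_square_def)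
next
  assume "is_square x"
  then obtain y where "x = y ^ 2" by (auto simp: is_square_def)
  then have "\<tau> x = (\<tau> y) ^ 2" by (simp add: power2_eq_square field_automorphismsD[OF assms])
  then show "is_square (\<tau> x)" by (auto simp: is_square_def)
qed

definition map_vec2 :: "('a \<Rightarrow> 'a) \<Rightarrow> 'a ^ 2 \<Rightarrow> 'a::zero ^ 2" where
  "map_vec2 \<tau> v = V2 (\<tau> (v $ 1)) (\<tau> (v $ 2))"

context
  fixes \<tau> :: "'a::field \<Rightarrow> 'a"
  assumes \<tau>: "\<tau> \<in> field_automorphisms"
begin

lemma map_vec2_mult: "map_matrix \<tau> g *v map_vec2 \<tau> v = map_vec2 \<tau> (g *v v)"
  by (cases g rule: M2_cases; cases v) (simp add: map_vec2_def M2_simps field_automorphismsD[OF \<tau>])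

lemma map_vec2_smult: "map_vec2 \<tau> (r *s v) = \<tau> r *s map_vec2 \<tau> v"
  by (cases v) (simp add: map_vec2_def M2_simps field_automorphismsD[OF \<tau>])

lemma map_vec2_eq_0_iff: "map_vec2 \<tau> v = 0 \<longleftrightarrow> v = 0"
  by (cases v) (simp add: map_vec2_def M2_simps(1) field_automorphism_eq_0_iff[OF \<tau>])

lemma area_map_vec2: "area (map_vec2 \<tau> v) (map_vec2 \<tau> w) = \<tau> (area v w)"
  by (simp add: map_vec2_def area_def field_automorphismsD[OF \<tau>] diff_conv_add_uminus del: add_uminus_conv_diff)

lemma map_vec2_surj: "\<exists>v. w = map_vec2 \<tau> v"
proof -
  obtain a b where "\<tau> a = w $ 1" "\<tau> b = w $ 2" using field_automorphismsD(7)[OF \<tau>] by (metis surjD)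
  then have "w = map_vec2 \<tau> (V2 a b)" by (simp add: map_vec2_def V2_eta)
  then show ?thesis by (rule exI)
qed

lemma map_matrix_det: "det (map_matrix \<tau> g) = \<tau> (det g)" for g :: "'a ^ 2 ^ 2"
  by (cases g rule: M2_cases)
    (simp add: M2_simps field_automorphismsD[OF \<tau>] diff_conv_add_uminus del: add_uminus_conv_diff)

lemma field_automorphism_auto: "(\<lambda>g \<in> carrier SL2. map_matrix \<tau> g) \<in> auto (SL2 :: ('a ^ 2 ^ 2) monoid)"
proof -
  have "(\<lambda>g \<in> carrier SL2. map_matrix \<tau> g) \<in> carrier PermSL2"
  proof (rule PermSL2_I[of _ "map_matrix (inv_into UNIV \<tau>)"])
    fix g :: "'a ^ 2 ^ 2" assume g: "g \<in> carrier SL2"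
    have *: "inv_into UNIV \<tau> (\<tau> x) = x" "\<tau> (inv_into UNIV \<tau> x) = x" for x
      using field_automorphismsD(6,7)[OF \<tau>] by (simp_all add: surj_f_inv_f)
    have inverse: "map_matrix (inv_into UNIV \<tau>) (map_matrix \<tau> g) = g" "map_matrix \<tau> (map_matrix (inv_into UNIV \<tau>) g) = g" for g :: "'a ^ 2 ^ 2"
      by (simp_all add: vec_eq_iff *)
    have "\<tau> (det (map_matrix (inv_into UNIV \<tau>) g)) = 1"
      using map_matrix_det[of "map_matrix (inv_into UNIV \<tau>) g"] g by (simp add: inverse carrier_SL2)
    then have "det (map_matrix (inv_into UNIV \<tau>) g) = 1" using field_automorphismsD(3,6)[OF \<tau>] by (metis injD)
    then show "map_matrix \<tau> g \<in> carrier SL2 \<and> map_matrix (inv_into UNIV \<tau>) g \<in> carrier SL2 \<and>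
        map_matrix (inv_into UNIV \<tau>) (map_matrix \<tau> g) = g \<and> map_matrix \<tau> (map_matrix (inv_into UNIV \<tau>) g) = g"
      using g by (simp add: inverse carrier_SL2 map_matrix_det field_automorphismsD[OF \<tau>])
  qed
  moreover have "map_matrix \<tau> (g ** h) = map_matrix \<tau> g ** map_matrix \<tau> h" for g h :: "'a ^ 2 ^ 2"
    by (rule map_matrix_mult) (simp_all add: field_automorphismsD[OF \<tau>])
  ultimately show ?thesis
    by (auto simp: auto_def hom_def carrier_PermSL2 carrier_SL2 det_mul map_matrix_det field_automorphismsD[OF \<tau>])
qed

end

text \<open>Stated for all invertible matrices, since the matrix \<open>c\<close> of the theorem has
  determinant -1.\<close>

lemma gamma_auto:
  fixes a :: "'a::field ^ 2 ^ 2"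
  assumes a: "det a \<noteq> 0"
  shows "gamma a \<in> auto SL2"
proof -
  note [simp] = SL2_conj[OF a]
  have assoc: "matrix_inv a ** (a ** g) = g" "a ** (matrix_inv a ** g) = g" for g
    by (simp_all add: matrix_mul_assoc)
  have "gamma a \<in> carrier PermSL2"
    unfolding gamma_def
  proof (rule PermSL2_I[of _ "\<lambda>g. a ** g ** matrix_inv a"])
    show "matrix_inv a ** g ** a \<in> carrier SL2 \<and> a ** g ** matrix_inv a \<in> carrier SL2 \<and>
        a ** (matrix_inv a ** g ** a) ** matrix_inv a = g \<and> matrix_inv a ** (a ** g ** matrix_inv a) ** a = g"
      if "g \<in> carrier SL2" for g
      using that a by (auto simp: carrier_SL2 det_mul) (simp_all add: assoc flip: matrix_mul_assoc)
  qed
  moreover have "matrix_inv a ** (g ** h) ** a = (matrix_inv a ** g ** a) ** (matrix_inv a ** h ** a)" for g h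
    by (simp add: assoc flip: matrix_mul_assoc)
  ultimately show ?thesis using a
    by (auto simp: auto_def hom_def carrier_PermSL2 gamma_def carrier_SL2 det_mul)
qed

text \<open>One inclusion is enough, because both sides have \<open>CARD('a)\<close>
  elements.\<close>

lemma image_transporter:
  fixes v w v' w' :: "'a::{field,finite} ^ 2"
  assumes \<sigma>: "\<sigma> \<in> carrier PermSL2" and nz: "v \<noteq> 0" "w \<noteq> 0" "v' \<noteq> 0" "w' \<noteq> 0"
    and img: "\<And>g. g \<in> carrier SL2 \<Longrightarrow> g *v v = w \<Longrightarrow> \<sigma> g *v v' = w'"
  shows "\<sigma> ` transporter v w = transporter v' w'"
proof (rule card_subset_eq)
  show "\<sigma> ` transporter v w \<subseteq> transporter v' w'"
    using img PermSL2_closed[OF \<sigma>] by (auto simp: transporter_def)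
  show "card (\<sigma> ` transporter v w) = card (transporter v' w')"
    using card_image[OF inj_on_subset[OF PermSL2_inj_on[OF \<sigma>] transporter_subset]] nz
    by (simp add: card_transporter)
qed simp

section \<open>Criteria for fixing \<open>pi_odd\<close>\<close>

lemma cls_Pow: "cls u \<subseteq> Pow (carrier SL2)"
  unfolding cls_def using transporter_subset by auto

text \<open>Injectivity and finiteness turn inclusions into equalities: all classes have the same
  size, so mapping each class into a class makes the images full classes, and then
  \<open>pi_odd\<close> is mapped onto itself.\<close>

lemma act_pi_oddI:
  fixes \<sigma> :: "'a::{field,finite} ^ 2 ^ 2 \<Rightarrow> 'a ^ 2 ^ 2"
  assumes \<sigma>: "\<sigma> \<in> carrier PermSL2"
    and M: "\<And>u. u \<noteq> 0 \<Longrightarrow> M u \<noteq> 0" "\<And>u X. u \<noteq> 0 \<Longrightarrow> X \<in> cls u \<Longrightarrow> \<sigma> ` X \<in> cls (M u)"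
  shows "act_on_parallelism \<sigma> pi_odd = pi_odd"
proof -
  have inj1: "inj_on (image \<sigma>) (Pow (carrier SL2))"
    by (rule inj_on_image_Pow[OF PermSL2_inj_on[OF \<sigma>]])
  have inj2: "inj_on (image (image \<sigma>)) (Pow (Pow (carrier SL2)))"
    by (rule inj_on_image_Pow[OF inj1])
  have "image \<sigma> ` cls u = cls (M u)" if u: "u \<noteq> 0" for u
  proof (rule card_subset_eq)
    show "image \<sigma> ` cls u \<subseteq> cls (M u)" using M(2)[OF u] by auto
    show "card (image \<sigma> ` cls u) = card (cls (M u))"
      using card_image[OF inj_on_subset[OF inj1 cls_Pow]] M(1)[OF u] u by (simp add: card_cls)
  qed simp
  then have "image (image \<sigma>) ` pi_odd \<subseteq> pi_odd" using M(1) by (simp add: pi_odd_eq) blast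
  moreover have "card (image (image \<sigma>) ` pi_odd) = card (pi_odd :: ('a ^ 2 ^ 2) set set set)"
    by (rule card_image, rule inj_on_subset[OF inj2]) (use cls_Pow in \<open>auto simp: pi_odd_eq\<close>)
  ultimately have "image (image \<sigma>) ` pi_odd = pi_odd"
    by (intro card_subset_eq) simp_all
  then show ?thesis by (simp add: act_on_parallelism_def)
qed

text \<open>Here \<open>K\<close> acts on the source of a pair and \<open>M\<close> on its target,
  and the label is moved by \<open>M\<close>. The two parts of \<open>zero\<close> serve the labels
  that come from the source and from the target, respectively.\<close>

lemma act_pi_odd_of_isometry:
  fixes \<sigma> :: "'a::{field,finite} ^ 2 ^ 2 \<Rightarrow> 'a ^ 2 ^ 2"
  assumes \<sigma>: "\<sigma> \<in> carrier PermSL2"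
    and nz: "\<And>v. v \<noteq> 0 \<Longrightarrow> K v \<noteq> 0 \<and> M v \<noteq> 0"
    and KM: "\<And>g v. g \<in> carrier SL2 \<Longrightarrow> \<sigma> g *v K v = M (g *v v)"
    and sq: "\<And>v w. is_square (area (K v) (M w)) \<longleftrightarrow> is_square (area v w)"
    and zero: "\<And>v w. area v w = 0 \<Longrightarrow> area (K v) (M w) = 0 \<and> area (M v) (M w) = 0"
  shows "act_on_parallelism \<sigma> pi_odd = pi_odd"
proof (rule act_pi_oddI[OF \<sigma>])
  fix u :: "'a ^ 2" and X assume u: "u \<noteq> 0" "X \<in> cls u"
  then obtain v w where vw: "X = transporter v w" "v \<noteq> 0" "w \<noteq> 0" by (elim clsE)
  have "\<sigma> ` X = transporter (K v) (M w)"
    unfolding vw(1) using vw nz KM by (intro image_transporter[OF \<sigma>]) auto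
  moreover have "if is_square (area v w) then area w u = 0 else area v u = 0"
    using u vw by (simp add: transporter_in_cls_iff)
  ultimately show "\<sigma> ` X \<in> cls (M u)"
    using u vw nz sq zero by (auto simp: transporter_in_cls_iff split: if_splits)
qed (use nz in auto)

section \<open>The stabilizer\<close>

definition pi_stabilizer :: "('a::field ^ 2 ^ 2 \<Rightarrow> 'a ^ 2 ^ 2) set" where
  "pi_stabilizer = stabilizer (PermSL2\<lparr>carrier := auto_trans\<rparr>) act_on_parallelism pi_odd"

lemma pi_stabilizer_iff:
  "\<sigma> \<in> pi_stabilizer \<longleftrightarrow> \<sigma> \<in> auto_trans \<and> act_on_parallelism \<sigma> pi_odd = pi_odd"
  by (simp add: pi_stabilizer_def stabilizer_def)

lemma auto_trans_in_PermSL2: "\<sigma> \<in> auto_trans \<Longrightarrow> \<sigma> \<in> carrier PermSL2"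
  using subgroup.subset[OF subgroup_auto_trans] by auto

lemma pi_stabilizer_in_PermSL2: "\<sigma> \<in> pi_stabilizer \<Longrightarrow> \<sigma> \<in> carrier PermSL2"
  by (simp add: pi_stabilizer_iff auto_trans_in_PermSL2)

lemma act_one: "act_on_parallelism \<one>\<^bsub>PermSL2\<^esub> pi_odd = (pi_odd :: ('a::field ^ 2 ^ 2) set set set)"
proof -
  have "(\<lambda>X. \<one>\<^bsub>PermSL2\<^esub> ` X) ` C = (\<lambda>X. X) ` C" if C: "C \<in> pi_odd" for C :: "('a ^ 2 ^ 2) set set"
  proof (rule image_cong[OF refl])
    fix X assume "X \<in> C"
    then have "X \<subseteq> carrier SL2" using C cls_Pow by (auto simp: pi_odd_eq)
    then have "\<one>\<^bsub>PermSL2\<^esub> ` X = (\<lambda>g. g) ` X" by (intro image_cong refl) auto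
    then show "\<one>\<^bsub>PermSL2\<^esub> ` X = X" by simp
  qed
  then show ?thesis by (simp add: act_on_parallelism_def)
qed

lemma act_mult:
  "act_on_parallelism (\<alpha> \<otimes>\<^bsub>PermSL2\<^esub> \<beta>) pi_odd =
    act_on_parallelism \<beta> (act_on_parallelism \<alpha> (pi_odd :: ('a::field ^ 2 ^ 2) set set set))"
proof -
  have "(\<alpha> \<otimes>\<^bsub>PermSL2\<^esub> \<beta>) ` X = \<beta> ` \<alpha> ` X" if "X \<in> C" "C \<in> pi_odd" for X C
  proof -
    have "X \<subseteq> carrier SL2" using that cls_Pow by (auto simp: pi_odd_eq)
    then have "(\<alpha> \<otimes>\<^bsub>PermSL2\<^esub> \<beta>) g = \<beta> (\<alpha> g)" if "g \<in> X" for g using that by auto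
    then show ?thesis by (simp add: image_image)
  qed
  then show ?thesis by (simp add: act_on_parallelism_def image_image)
qed

lemma subgroup_pi_stabilizer: "subgroup pi_stabilizer PermSL2"
proof (rule group.subgroupI[OF group_PermSL2])
  show "pi_stabilizer \<subseteq> carrier PermSL2" using pi_stabilizer_in_PermSL2 by auto
  have "\<one>\<^bsub>PermSL2\<^esub> \<in> pi_stabilizer"
    by (simp add: pi_stabilizer_iff act_one subgroup.one_closed[OF subgroup_auto_trans])
  then show "pi_stabilizer \<noteq> {}" by auto
next
  fix \<alpha> :: "'a ^ 2 ^ 2 \<Rightarrow> 'a ^ 2 ^ 2" assume \<alpha>: "\<alpha> \<in> pi_stabilizer"
  let ?\<beta> = "inv\<^bsub>PermSL2\<^esub> \<alpha>"
  have "act_on_parallelism ?\<beta> (act_on_parallelism \<alpha> pi_odd) = pi_odd"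
    unfolding act_mult[symmetric] by (simp add: group.r_inv[OF group_PermSL2 pi_stabilizer_in_PermSL2[OF \<alpha>]] act_one)
  then show "?\<beta> \<in> pi_stabilizer"
    using \<alpha> subgroup.m_inv_closed[OF subgroup_auto_trans, of \<alpha>] by (simp add: pi_stabilizer_iff)
next
  fix \<alpha> \<beta> :: "'a ^ 2 ^ 2 \<Rightarrow> 'a ^ 2 ^ 2" assume "\<alpha> \<in> pi_stabilizer" "\<beta> \<in> pi_stabilizer"
  then show "\<alpha> \<otimes>\<^bsub>PermSL2\<^esub> \<beta> \<in> pi_stabilizer"
    using subgroup.m_closed[OF subgroup_auto_trans, of \<alpha> \<beta>] by (simp add: pi_stabilizer_iff act_mult)
qed

section \<open>\<open>PSigmaL2\<close> inside the stabilizer\<close>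

lemma gamma_vec:
  fixes a :: "'a::field ^ 2 ^ 2"
  assumes "det a \<noteq> 0" "g \<in> carrier SL2"
  shows "gamma a g *v (matrix_inv a *v v) = matrix_inv a *v (g *v v)"
proof -
  have "gamma a g *v (matrix_inv a *v v) = matrix_inv a *v (g *v ((a ** matrix_inv a) *v v))"
    using assms(2) by (simp add: gamma_def matrix_vector_mul_assoc matrix_mul_assoc)
  then show ?thesis by (simp add: SL2_conj[OF assms(1)])
qed

lemma matrix_inv_vec_eq_0_iff:
  fixes a :: "'a::field ^ 2 ^ 2"
  assumes "det a \<noteq> 0"
  shows "matrix_inv a *v v = 0 \<longleftrightarrow> v = 0"
proof
  assume "matrix_inv a *v v = 0"
  then have "(a ** matrix_inv a) *v v = 0" by (simp flip: matrix_vector_mul_assoc)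
  then show "v = 0" by (simp add: SL2_conj[OF assms])
qed simp

lemma gamma_in_pi_stabilizer:
  fixes h :: "'a::{field,finite} ^ 2 ^ 2"
  assumes h: "h \<in> carrier SL2"
  shows "gamma h \<in> pi_stabilizer"
proof -
  have det: "det h \<noteq> 0" "det h = 1" using h by (simp_all add: carrier_SL2)
  have "act_on_parallelism (gamma h) pi_odd = pi_odd"
    by (rule act_pi_odd_of_isometry[of _ "\<lambda>v. matrix_inv h *v v" "\<lambda>v. matrix_inv h *v v"])
      (simp_all add: auto_in_PermSL2 gamma_auto det gamma_vec matrix_inv_vec_eq_0_iff area_mult SL2_conj)
  then show ?thesis by (simp add: pi_stabilizer_iff auto_trans_incl gamma_auto det)
qed

lemma field_automorphism_in_pi_stabilizer:
  fixes \<tau> :: "'a::{field,finite} \<Rightarrow> 'a"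
  assumes \<tau>: "\<tau> \<in> field_automorphisms"
  shows "(\<lambda>g \<in> carrier SL2. map_matrix \<tau> g) \<in> pi_stabilizer"
proof -
  have "act_on_parallelism (\<lambda>g \<in> carrier SL2. map_matrix \<tau> g) pi_odd = pi_odd"
    by (rule act_pi_odd_of_isometry[of _ "map_vec2 \<tau>" "map_vec2 \<tau>"])
      (simp_all add: auto_in_PermSL2 field_automorphism_auto \<tau> map_vec2_mult map_vec2_eq_0_iff
        area_map_vec2 field_automorphism_is_square field_automorphism_eq_0_iff)
  then show ?thesis by (simp add: pi_stabilizer_iff auto_trans_incl field_automorphism_auto \<tau>)
qed

lemma PSigmaL2_subset: "PSigmaL2 \<subseteq> (pi_stabilizer :: ('a::{field,finite} ^ 2 ^ 2 \<Rightarrow> 'a ^ 2 ^ 2) set)"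
  unfolding PSigmaL2_def
  by (rule group.generate_subgroup_incl[OF group_PermSL2 _ subgroup_pi_stabilizer])
    (auto simp: gamma_in_pi_stabilizer field_automorphism_in_pi_stabilizer)

lemma uminus_SL2 [simp]: "- g \<in> carrier SL2 \<longleftrightarrow> g \<in> carrier SL2"
  by (cases g rule: M2_cases) (simp add: carrier_SL2 M2_simps)

lemma uminus_matrix_mult:
  "- (a :: 'a::comm_ring_1 ^ 2 ^ 2) ** b = - (a ** (b :: 'a ^ 2 ^ 2))" "a ** - b = - (a ** (b :: 'a ^ 2 ^ 2))"
  by (cases a rule: M2_cases; cases b rule: M2_cases; simp add: M2_simps)+

text \<open>Both values can be checked on generators. The value at \<open>- mat 1\<close> enters the
  proof that \<open>PSigmaL2\<close> is normal in the stabilizer.\<close>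

lemma PSigmaL2_fixes:
  assumes "\<sigma> \<in> PSigmaL2"
  shows "\<sigma> (mat 1) = mat 1" "\<sigma> (- mat 1) = - (mat 1 :: 'a::field ^ 2 ^ 2)"
proof -
  let ?F = "{\<sigma> \<in> carrier PermSL2. \<sigma> (mat 1) = mat 1 \<and> \<sigma> (- mat 1) = - (mat 1 :: 'a ^ 2 ^ 2)}"
  have "subgroup ?F PermSL2"
  proof (rule group.subgroupI[OF group_PermSL2])
    have "\<one>\<^bsub>PermSL2\<^esub> \<in> ?F" using monoid.one_closed[OF group.is_monoid[OF group_PermSL2]] by simp
    then show "?F \<noteq> {}" by (metis (no_types, lifting) empty_iff)
  next
    fix \<alpha> assume \<alpha>: "\<alpha> \<in> ?F"
    then have \<alpha>': "\<alpha> \<in> carrier PermSL2" by simp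
    show "inv\<^bsub>PermSL2\<^esub> \<alpha> \<in> ?F"
      using PermSL2_inv_apply(1)[OF \<alpha>', of "mat 1"] PermSL2_inv_apply(1)[OF \<alpha>', of "- mat 1"] \<alpha>
        group.inv_closed[OF group_PermSL2 \<alpha>'] by simp
  qed (auto simp: monoid.m_closed[OF group.is_monoid[OF group_PermSL2]])
  moreover have "gamma h \<in> ?F" if h: "h \<in> carrier SL2" for h
  proof -
    have "det h \<noteq> 0" using h by (simp add: carrier_SL2)
    then show ?thesis
      by (simp add: auto_in_PermSL2 gamma_auto) (simp add: gamma_def uminus_matrix_mult SL2_conj)
  qed
  moreover have "(\<lambda>g \<in> carrier SL2. map_matrix \<tau> g) \<in> ?F" if \<tau>: "\<tau> \<in> field_automorphisms" for \<tau>
  proof -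
    have "map_matrix \<tau> (- mat 1) = - (mat 1 :: 'a ^ 2 ^ 2)"
      by (simp add: M2_simps field_automorphismsD[OF \<tau>])
    then show ?thesis using auto_one[OF field_automorphism_auto[OF \<tau>]]
      by (simp add: auto_in_PermSL2 field_automorphism_auto \<tau>)
  qed
  ultimately have "PSigmaL2 \<subseteq> ?F" unfolding PSigmaL2_def
    by (intro group.generate_subgroup_incl[OF group_PermSL2]) auto
  then show "\<sigma> (mat 1) = mat 1" "\<sigma> (- mat 1) = - mat 1" using assms by auto
qed

section \<open>Constraints on permutations that stabilize \<open>pi_odd\<close>\<close>

lemma auto_trans_semilinear:
  fixes \<sigma> :: "'a::{field,finite} ^ 2 ^ 2 \<Rightarrow> 'a ^ 2 ^ 2"
  assumes p: "prime p" "e \<ge> 1" "CARD('a) = p ^ e" and \<sigma>: "\<sigma> \<in> auto_trans"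
  obtains b \<tau> where "det b \<noteq> 0" "\<tau> \<in> field_automorphisms"
    "\<And>g. g \<in> carrier SL2 \<Longrightarrow> \<sigma> g ** adj (\<sigma> (mat 1)) ** b = b ** map_matrix \<tau> g"
  using SL2_automorphism[OF p auto_trans_linear_part[OF \<sigma>]] by (metis (no_types, lifting) restrict_apply')

text \<open>Every vector is an eigenvector. The two basis vectors force a diagonal matrix, their sum
  forces equal diagonal entries, and determinant 1 leaves only the two signs.\<close>

lemma SL2_scalar:
  fixes g :: "'a::field ^ 2 ^ 2"
  assumes g: "g \<in> carrier SL2" and *: "\<And>v. area (g *v v) v = 0"
  shows "g = mat 1 \<or> g = - mat 1"
proof -
  obtain a b c d where abcd: "g = M2 a b c d" by (rule M2_cases)
  have "c = 0" using *[of "V2 1 0"] by (simp add: abcd M2_simps)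
  moreover have "b = 0" using *[of "V2 0 1"] by (simp add: abcd M2_simps)
  ultimately have "a = d" using *[of "V2 1 1"] by (simp add: abcd M2_simps)
  then have "a ^ 2 = 1" using g \<open>b = 0\<close> by (simp add: abcd M2_simps carrier_SL2 power2_eq_square)
  then have "a = 1 \<or> a = - 1" by (simp add: power2_eq_1_iff)
  then show ?thesis using \<open>a = d\<close> \<open>b = 0\<close> \<open>c = 0\<close> by (auto simp: abcd M2_simps)
qed

lemma adj_uminus_one: "adj (mat 1) = (mat 1 :: 'a::comm_ring_1 ^ 2 ^ 2)"
    "adj (- mat 1) = (- mat 1 :: 'a::comm_ring_1 ^ 2 ^ 2)"
  by (simp_all add: adj_def M2_simps)

lemma adj_adj [simp]: "adj (adj g) = g"
  by (cases g rule: M2_cases) (simp add: adj_def)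

lemma pi_stabilizer_cases:
  fixes \<sigma> :: "'a::{field,finite} ^ 2 ^ 2 \<Rightarrow> 'a ^ 2 ^ 2"
  assumes p: "prime p" "e \<ge> 1" "CARD('a) = p ^ e" and odd: "odd CARD('a)" and \<sigma>: "\<sigma> \<in> pi_stabilizer"
  shows "\<sigma> (mat 1) = mat 1 \<or> \<sigma> (mat 1) = - mat 1" "\<sigma> (mat 1) = mat 1 \<Longrightarrow> \<sigma> \<in> PSigmaL2"
proof -
  have \<sigma>': "\<sigma> \<in> auto_trans" "act_on_parallelism \<sigma> pi_odd = pi_odd" using \<sigma> by (simp_all add: pi_stabilizer_iff)
  note \<sigma>P = auto_trans_in_PermSL2[OF \<sigma>'(1)]
  define h where "h = \<sigma> (mat 1)"
  have h: "h \<in> carrier SL2" unfolding h_def by (rule PermSL2_closed[OF \<sigma>P]) simp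
  obtain b \<tau> where b: "det b \<noteq> 0" and \<tau>: "\<tau> \<in> field_automorphisms"
    and \<sigma>b: "\<And>g. g \<in> carrier SL2 \<Longrightarrow> \<sigma> g ** adj h ** b = b ** map_matrix \<tau> g"
    using auto_trans_semilinear[OF p \<sigma>'(1)] unfolding h_def by metis
  \<comment> \<open>A pair \<open>(v, w)\<close> will be sent to \<open>(K v, M w)\<close>: the
    translation by \<open>h\<close> affects only the source vector.\<close>
  define M where "M = (\<lambda>v. b *v map_vec2 \<tau> v)"
  define K where "K = (\<lambda>v. adj h *v M v)"
  have b_inv: "matrix_inv b *v (b *v v) = v" "b *v (matrix_inv b *v v) = v" for v
    by (simp_all add: matrix_vector_mul_assoc SL2_conj[OF b])
  have M_nz: "M v \<noteq> 0" if "v \<noteq> 0" for v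
  proof
    assume "M v = 0"
    then have "map_vec2 \<tau> v = 0" using b_inv(1)[of "map_vec2 \<tau> v"] by (simp add: M_def)
    then show False using that by (simp add: map_vec2_eq_0_iff[OF \<tau>])
  qed
  have K_nz: "K v \<noteq> 0" if "v \<noteq> 0" for v using M_nz[OF that] h by (simp add: K_def)
  have M_smult: "M (r *s v) = \<tau> r *s M v" for r v
    by (simp add: M_def map_vec2_smult[OF \<tau>] vector_scalar_commute)
  have M_surj: "\<exists>v. x = M v" for x
    using map_vec2_surj[OF \<tau>, of "matrix_inv b *v x"] b_inv(2)[of x] unfolding M_def by metis
  have img: "\<sigma> ` transporter v w = transporter (K v) (M w)" if nz: "v \<noteq> 0" "w \<noteq> 0" for v w
  proof (rule image_transporter[OF \<sigma>P nz K_nz[OF nz(1)] M_nz[OF nz(2)]])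
    fix g assume g: "g \<in> carrier SL2" "g *v v = w"
    have "\<sigma> g *v K v = (\<sigma> g ** adj h ** b) *v map_vec2 \<tau> v"
      by (simp add: K_def M_def matrix_vector_mul_assoc matrix_mul_assoc)
    also have "\<dots> = b *v (map_matrix \<tau> g *v map_vec2 \<tau> v)"
      by (simp add: \<sigma>b[OF g(1)] matrix_vector_mul_assoc)
    also have "\<dots> = M w" by (simp add: M_def map_vec2_mult[OF \<tau>] g)
    finally show "\<sigma> g *v K v = M w" .
  qed
  have cls_img: "\<exists>u'. u' \<noteq> 0 \<and> (\<forall>X \<in> cls u. \<sigma> ` X \<in> cls u')" if u: "u \<noteq> 0" for u :: "'a ^ 2"
  proof -
    have "image \<sigma> ` cls u \<in> act_on_parallelism \<sigma> pi_odd"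
      using u by (auto simp: act_on_parallelism_def pi_odd_eq)
    then obtain u' where "u' \<noteq> 0" "image \<sigma> ` cls u = cls u'" unfolding \<sigma>'(2) by (auto simp: pi_odd_eq)
    then show ?thesis by (intro exI[of _ u']) auto
  qed
  \<comment> \<open>The pairs \<open>(v, r *s v)\<close> with \<open>r \<noteq> 0\<close> all have
    area 0 and belong to \<open>cls v\<close>, so their images share one class. If the image areas
    were nonzero, they would run through all nonzero scalars.\<close>
  have collinear: "area (K v) (M v) = 0" for v
  proof (cases "v = 0")
    case False
    obtain u where u: "u \<noteq> 0" and cls_u: "\<And>X. X \<in> cls v \<Longrightarrow> \<sigma> ` X \<in> cls u" using cls_img[OF False] by auto
    have mem: "transporter (K v) (\<tau> r *s M v) \<in> cls u" if r: "r \<noteq> 0" for r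
    proof -
      have "transporter v (r *s v) \<in> cls v" using False r by (simp add: transporter_in_cls_iff)
      from cls_u[OF this] show ?thesis using img[of v "r *s v"] False r by (simp add: M_smult)
    qed
    have mem': "transporter (K v) (t *s M v) \<in> cls u" if t: "t \<noteq> 0" for t
    proof -
      obtain r where r: "t = \<tau> r" using field_automorphismsD(7)[OF \<tau>] by (metis surjD)
      then show ?thesis using mem[of r] t field_automorphismsD(4)[OF \<tau>] by auto
    qed
    show ?thesis
    proof (rule ccontr)
      assume a: "area (K v) (M v) \<noteq> 0"
      obtain n :: 'a where n: "\<not> is_square n" using ex_nonsquare[OF odd] by auto
      then have "n \<noteq> 0" by auto
      \<comment> \<open>The scalar makes the area equal to 1, a square, so the label is the line of
        \<open>M v\<close>. The next scalar gives area \<open>n\<close>, a nonsquare, so the label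
        is also the line of \<open>K v\<close>.\<close>
      have "area (M v) u = 0"
        using mem'[of "1 / area (K v) (M v)"] a u M_nz[OF False] K_nz[OF False] by (simp add: transporter_in_cls_iff)
      moreover have "area (K v) u = 0"
        using mem'[of "n / area (K v) (M v)"] a u n \<open>n \<noteq> 0\<close> M_nz[OF False] K_nz[OF False]
        by (simp add: transporter_in_cls_iff)
      ultimately have "area (K v) (M v) = 0"
        using area_eq_0_trans[OF u, of "K v" "M v"] area_commute[of u] by simp
      then show False using a by simp
    qed
  qed (simp add: M_def map_vec2_eq_0_iff[OF \<tau>, THEN iffD2] area_def)
  have "area (adj h *v x) x = 0" for x
    using M_surj[of x] collinear by (auto simp: K_def)
  then have "adj h = mat 1 \<or> adj h = - mat 1" using SL2_scalar adj_closed[OF h] by blast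
  then have "adj (adj h) = mat 1 \<or> adj (adj h) = - mat 1" using adj_uminus_one by metis
  then show "\<sigma> (mat 1) = mat 1 \<or> \<sigma> (mat 1) = - mat 1" by (simp add: h_def)
  assume "\<sigma> (mat 1) = mat 1"
  then have "h = mat 1" by (simp add: h_def)
  then have KM: "K = M" by (simp add: K_def adj_uminus_one)
  let ?e1 = "V2 1 0 :: 'a ^ 2" and ?e2 = "V2 0 1 :: 'a ^ 2"
  have e: "?e1 \<noteq> 0" "?e2 \<noteq> 0" "area ?e1 ?e2 = 1" by (simp_all add: M2_simps)
  \<comment> \<open>The pairs \<open>(?e2, ?e2)\<close> and \<open>(?e1, ?e2)\<close> have the
    square areas 0 and 1 and share the class of \<open>?e2\<close>. Their images have areas 0 and
    \<open>det b\<close>; a nonsquare \<open>det b\<close> would give the second image the label of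
    \<open>M ?e1\<close> instead of \<open>M ?e2\<close>.\<close>
  obtain u where u: "u \<noteq> 0" and cls_u: "\<And>X. X \<in> cls ?e2 \<Longrightarrow> \<sigma> ` X \<in> cls u" using cls_img[OF e(2)] by auto
  have area_e: "area (M ?e1) (M ?e2) = det b"
    using area_map_vec2[OF \<tau>, of ?e1 ?e2] field_automorphismsD(3)[OF \<tau>] e(3) by (simp add: M_def area_mult)
  have "transporter ?e2 ?e2 \<in> cls ?e2" "transporter ?e1 ?e2 \<in> cls ?e2"
    using e by (simp_all add: transporter_in_cls_iff)
  then have "transporter (M ?e2) (M ?e2) \<in> cls u" "transporter (M ?e1) (M ?e2) \<in> cls u"
    using cls_u img e KM by metis+
  then have *: "area (M ?e2) u = 0" "\<not> is_square (det b) \<Longrightarrow> area (M ?e1) u = 0"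
    using u e M_nz area_e by (simp_all add: transporter_in_cls_iff)
  have "is_square (det b)"
  proof (rule ccontr)
    assume "\<not> is_square (det b)"
    then have "area (M ?e1) (M ?e2) = 0"
      using * area_eq_0_trans[OF u, of "M ?e1" "M ?e2"] area_commute[of u] by simp
    then show False using area_e b by simp
  qed
  then obtain y where y: "det b = y ^ 2" by (auto simp: is_square_def)
  then have "y \<noteq> 0" using b by auto
  \<comment> \<open>Dividing \<open>b\<close> by a square root of its determinant yields a matrix in
    \<open>SL2\<close> that induces the same conjugation.\<close>
  define k where "k = map_matrix (\<lambda>x. x / y) b"
  have k: "k \<in> carrier SL2"
    using y b \<open>y \<noteq> 0\<close> by (cases b rule: M2_cases)
      (simp add: k_def map_matrix_M2 det_M2 carrier_SL2 power2_eq_square flip: diff_divide_distrib)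
  have k_mult: "g ** k = map_matrix (\<lambda>x. x / y) (g ** b)" "k ** g = map_matrix (\<lambda>x. x / y) (b ** g)" for g
    by (cases b rule: M2_cases; cases g rule: M2_cases; simp add: k_def map_matrix_M2 M2_mult add_divide_distrib)+
  have \<sigma>k: "\<sigma> g = k ** map_matrix \<tau> g ** adj k" if g: "g \<in> carrier SL2" for g
  proof -
    have "\<sigma> g ** k = k ** map_matrix \<tau> g"
      using \<sigma>b[OF g] by (simp add: k_mult \<open>h = mat 1\<close> adj_uminus_one)
    then have "\<sigma> g ** k ** adj k = k ** map_matrix \<tau> g ** adj k" by simp
    then show ?thesis using k by simp
  qed
  let ?t = "\<lambda>g \<in> carrier SL2. map_matrix \<tau> g"
  have det_k: "det (adj k) \<noteq> 0" "adj k \<in> carrier SL2" using adj_closed[OF k] by (simp_all add: carrier_SL2)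
  have inv_k: "matrix_inv (adj k) = k"
  proof -
    have "matrix_inv (adj k) ** adj k ** k = k" by (simp add: SL2_conj[OF det_k(1)])
    then show ?thesis using k by simp
  qed
  have t: "?t \<in> carrier PermSL2" by (rule auto_in_PermSL2[OF field_automorphism_auto[OF \<tau>]])
  \<comment> \<open>Products apply the left factor first, and \<open>gamma\<close> conjugates with
    the inverse on the left, hence the argument \<open>adj k\<close>.\<close>
  have "\<sigma> = ?t \<otimes>\<^bsub>PermSL2\<^esub> gamma (adj k)"
  proof (rule PermSL2_ext[OF \<sigma>P])
    show "?t \<otimes>\<^bsub>PermSL2\<^esub> gamma (adj k) \<in> carrier PermSL2"
      by (intro monoid.m_closed[OF group.is_monoid[OF group_PermSL2]] t auto_in_PermSL2[OF gamma_auto[OF det_k(1)]])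
    fix g :: "'a ^ 2 ^ 2" assume g: "g \<in> carrier SL2"
    have "map_matrix \<tau> g \<in> carrier SL2" using PermSL2_closed[OF t g] g by simp
    then show "\<sigma> g = (?t \<otimes>\<^bsub>PermSL2\<^esub> gamma (adj k)) g"
      using g by (simp add: \<sigma>k gamma_def inv_k)
  qed
  moreover have "?t \<in> PSigmaL2" "gamma (adj k) \<in> PSigmaL2"
    unfolding PSigmaL2_def using \<tau> det_k(2) by (auto intro!: generate.incl)
  ultimately show "\<sigma> \<in> PSigmaL2" unfolding PSigmaL2_def by (auto intro: generate.eng)
qed

section \<open>Splitting by an involution that moves the identity matrix\<close>

lemma (in group) generate_involution:
  assumes "k \<in> carrier G" "k \<otimes> k = \<one>"
  shows "generate G {k} = {\<one>, k}"
proof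
  have inv: "inv k = k" using assms by (simp add: inv_equality)
  have "subgroup {\<one>, k} G"
    by (rule subgroupI) (use assms inv in auto)
  then show "generate G {k} \<subseteq> {\<one>, k}" by (intro generate_subgroup_incl) auto
  show "{\<one>, k} \<subseteq> generate G {k}" by (auto intro: generate.intros)
qed

text \<open>Everything is decided by the value at \<open>mat 1\<close>, which is
  \<open>mat 1\<close> exactly on \<open>PSigmaL2\<close> and \<open>- mat 1\<close> on the rest of
  the stabilizer. These values differ as the field has odd order, and composing with
  \<open>k\<close> exchanges the two cases.\<close>

lemma internal_semidirect_product_involution:
  fixes k :: "'a::{field,finite} ^ 2 ^ 2 \<Rightarrow> 'a ^ 2 ^ 2"
  assumes p: "prime p" "e \<ge> 1" "CARD('a) = p ^ e" and odd: "odd CARD('a)"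
    and k: "k \<in> pi_stabilizer" "k (mat 1) = - mat 1" "k \<otimes>\<^bsub>PermSL2\<^esub> k = \<one>\<^bsub>PermSL2\<^esub>"
  shows "internal_semidirect_product PermSL2 pi_stabilizer PSigmaL2 (generate PermSL2 {k})"
proof -
  interpret P: group "PermSL2 :: ('a ^ 2 ^ 2 \<Rightarrow> 'a ^ 2 ^ 2) monoid" by (rule group_PermSL2)
  interpret St: subgroup "pi_stabilizer :: ('a ^ 2 ^ 2 \<Rightarrow> 'a ^ 2 ^ 2) set" PermSL2
    by (rule subgroup_pi_stabilizer)
  note cases1 = pi_stabilizer_cases(1)[OF p odd] and cases2 = pi_stabilizer_cases(2)[OF p odd]
  have kP: "k \<in> carrier PermSL2" using k(1) by (rule pi_stabilizer_in_PermSL2)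
  have gen: "generate PermSL2 {k} = {\<one>\<^bsub>PermSL2\<^esub>, k}" by (rule P.generate_involution[OF kP k(3)])
  have k_neg: "k (- mat 1) = mat 1"
  proof -
    have "(k \<otimes>\<^bsub>PermSL2\<^esub> k) (mat 1) = mat 1" unfolding k(3) by simp
    then show ?thesis by (simp add: k(2))
  qed
  have one_neg: "(mat 1 :: 'a ^ 2 ^ 2) \<noteq> - mat 1"
    using odd_card_one_neq_minus_one[OF odd] by (simp add: M2_simps)
  have N: "subgroup (PSigmaL2 :: ('a ^ 2 ^ 2 \<Rightarrow> 'a ^ 2 ^ 2) set) PermSL2"
    unfolding PSigmaL2_def
    by (rule P.generate_is_subgroup)
      (auto simp: pi_stabilizer_in_PermSL2 gamma_in_pi_stabilizer field_automorphism_in_pi_stabilizer)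
  have grp: "group (PermSL2\<lparr>carrier := pi_stabilizer\<rparr> :: ('a ^ 2 ^ 2 \<Rightarrow> 'a ^ 2 ^ 2) monoid)"
    by (rule P.subgroup_imp_group[OF subgroup_pi_stabilizer])
  have "PSigmaL2 \<lhd> PermSL2\<lparr>carrier := pi_stabilizer :: ('a ^ 2 ^ 2 \<Rightarrow> 'a ^ 2 ^ 2) set\<rparr>"
  proof (rule group.normal_invI[OF grp])
    show "subgroup PSigmaL2 (PermSL2\<lparr>carrier := pi_stabilizer :: ('a ^ 2 ^ 2 \<Rightarrow> 'a ^ 2 ^ 2) set\<rparr>)"
      by (rule P.subgroup_incl[OF N subgroup_pi_stabilizer PSigmaL2_subset])
    fix x n :: "'a ^ 2 ^ 2 \<Rightarrow> 'a ^ 2 ^ 2"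
    assume x: "x \<in> carrier (PermSL2\<lparr>carrier := pi_stabilizer\<rparr>)" and n: "n \<in> PSigmaL2"
    then have xS: "x \<in> pi_stabilizer" and xP: "x \<in> carrier PermSL2" and nS: "n \<in> pi_stabilizer"
      using PSigmaL2_subset by (auto simp: pi_stabilizer_in_PermSL2)
    have "x \<otimes>\<^bsub>PermSL2\<^esub> n \<otimes>\<^bsub>PermSL2\<^esub> inv\<^bsub>PermSL2\<^esub> x \<in> PSigmaL2"
    proof (rule cases2)
      show "x \<otimes>\<^bsub>PermSL2\<^esub> n \<otimes>\<^bsub>PermSL2\<^esub> inv\<^bsub>PermSL2\<^esub> x \<in> pi_stabilizer"
        using xS nS by (intro St.m_closed St.m_inv_closed)
      \<comment> \<open>The conjugate applies \<open>x\<close>, then \<open>n\<close>, then the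
        inverse of \<open>x\<close>. As \<open>x (mat 1)\<close> is one of the two signs of
        \<open>mat 1\<close>, \<open>n\<close> fixes it.\<close>
      have "n (x (mat 1)) = x (mat 1)" using cases1[OF xS] PSigmaL2_fixes[OF n] by auto
      then show "(x \<otimes>\<^bsub>PermSL2\<^esub> n \<otimes>\<^bsub>PermSL2\<^esub> inv\<^bsub>PermSL2\<^esub> x) (mat 1) = mat 1"
        by (simp add: PermSL2_inv_apply[OF xP])
    qed
    then show "x \<otimes>\<^bsub>PermSL2\<lparr>carrier := pi_stabilizer\<rparr>\<^esub> n \<otimes>\<^bsub>PermSL2\<lparr>carrier := pi_stabilizer\<rparr>\<^esub>
        inv\<^bsub>PermSL2\<lparr>carrier := pi_stabilizer\<rparr>\<^esub> x \<in> PSigmaL2"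
      using P.m_inv_consistent[OF subgroup_pi_stabilizer xS] by simp
  qed
  moreover have "subgroup (generate PermSL2 {k}) (PermSL2\<lparr>carrier := pi_stabilizer\<rparr>)"
  proof (rule P.subgroup_incl[OF _ subgroup_pi_stabilizer])
    show "subgroup (generate PermSL2 {k}) PermSL2" using kP by (intro P.generate_is_subgroup) simp
    show "generate PermSL2 {k} \<subseteq> pi_stabilizer" unfolding gen using k(1) St.one_closed by simp
  qed
  moreover have "PSigmaL2 \<inter> generate PermSL2 {k} = {\<one>\<^bsub>PermSL2\<^esub>}"
    using PSigmaL2_fixes(1)[of k] k(2) one_neg subgroup.one_closed[OF N] by (auto simp: gen)
  moreover have "pi_stabilizer = PSigmaL2 <#>\<^bsub>PermSL2\<^esub> generate PermSL2 {k}"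
  proof (intro equalityI subsetI)
    fix x :: "'a ^ 2 ^ 2 \<Rightarrow> 'a ^ 2 ^ 2" assume x: "x \<in> pi_stabilizer"
    then have xP: "x \<in> carrier PermSL2" by (rule pi_stabilizer_in_PermSL2)
    show "x \<in> PSigmaL2 <#>\<^bsub>PermSL2\<^esub> generate PermSL2 {k}"
    proof (cases "x (mat 1) = mat 1")
      case True
      then have "x \<in> PSigmaL2" by (rule cases2[OF x])
      moreover have "x = x \<otimes>\<^bsub>PermSL2\<^esub> \<one>\<^bsub>PermSL2\<^esub>" using xP by simp
      ultimately show ?thesis unfolding set_mult_def gen by blast
    next
      case False
      then have "(x \<otimes>\<^bsub>PermSL2\<^esub> k) (mat 1) = mat 1" using cases1[OF x] k_neg by simp
      then have "x \<otimes>\<^bsub>PermSL2\<^esub> k \<in> PSigmaL2" using St.m_closed[OF x k(1)] by (intro cases2)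
      moreover have "x = x \<otimes>\<^bsub>PermSL2\<^esub> k \<otimes>\<^bsub>PermSL2\<^esub> k" using xP kP k(3) by (simp add: P.m_assoc)
      ultimately show ?thesis unfolding set_mult_def gen by blast
    qed
  next
    fix x :: "'a ^ 2 ^ 2 \<Rightarrow> 'a ^ 2 ^ 2" assume "x \<in> PSigmaL2 <#>\<^bsub>PermSL2\<^esub> generate PermSL2 {k}"
    then obtain n m where "n \<in> PSigmaL2" "m = \<one>\<^bsub>PermSL2\<^esub> \<or> m = k" "x = n \<otimes>\<^bsub>PermSL2\<^esub> m"
      by (auto simp: set_mult_def gen)
    then show "x \<in> pi_stabilizer" using PSigmaL2_subset k(1) St.one_closed St.m_closed by blast
  qed
  ultimately show ?thesis
    unfolding internal_semidirect_product_def using subgroup_pi_stabilizer by blast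
qed

text \<open>Up to right multiplication by a fixed matrix, \<open>\<sigma>\<close> is a conjugation
  after a field automorphism, and all of these commute with negation. Hence
  \<open>rho (- mat 1)\<close> is central, which makes the product direct in the first case.\<close>

lemma auto_trans_uminus:
  fixes \<sigma> :: "'a::{field,finite} ^ 2 ^ 2 \<Rightarrow> 'a ^ 2 ^ 2"
  assumes p: "prime p" "e \<ge> 1" "CARD('a) = p ^ e" and \<sigma>: "\<sigma> \<in> auto_trans" and g: "g \<in> carrier SL2"
  shows "\<sigma> (- g) = - \<sigma> g"
proof -
  obtain b \<tau> where b: "det b \<noteq> 0" and \<tau>: "\<tau> \<in> field_automorphisms"
    and \<sigma>b: "\<And>g. g \<in> carrier SL2 \<Longrightarrow> \<sigma> g ** adj (\<sigma> (mat 1)) ** b = b ** map_matrix \<tau> g"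
    using auto_trans_semilinear[OF p \<sigma>] by metis
  have h: "\<sigma> (mat 1) \<in> carrier SL2" by (rule PermSL2_closed[OF auto_trans_in_PermSL2[OF \<sigma>]]) simp
  have "map_matrix \<tau> (- g) = - map_matrix \<tau> g"
    by (cases g rule: M2_cases) (simp add: M2_simps field_automorphismsD[OF \<tau>])
  then have "\<sigma> (- g) ** adj (\<sigma> (mat 1)) ** b = - \<sigma> g ** adj (\<sigma> (mat 1)) ** b"
    using g by (simp add: \<sigma>b uminus_matrix_mult)
  then have "\<sigma> (- g) ** adj (\<sigma> (mat 1)) ** b ** matrix_inv b ** \<sigma> (mat 1) =
      - \<sigma> g ** adj (\<sigma> (mat 1)) ** b ** matrix_inv b ** \<sigma> (mat 1)" by simp
  then show ?thesis using h
    by (simp add: matrix_mul_assoc[of _ b, symmetric] SL2_conj[OF b])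
qed

section \<open>The involutions for the two residues of \<open>q\<close> modulo 4\<close>

lemma rho_minus_one_vec: "g \<in> carrier SL2 \<Longrightarrow> rho (- mat 1) g = - g"
  by (simp add: rho_def uminus_matrix_mult)

lemma uminus_mult_vec: "- (a :: 'a::comm_ring_1 ^ 2 ^ 2) *v - v = a *v (v :: 'a ^ 2)"
  by (cases a rule: M2_cases; cases v) (simp add: M2_simps)

text \<open>The translation replaces the source \<open>v\<close> by \<open>- v\<close> and so
  negates areas. Multiplication by -1 preserves squares when -1 is itself a square.\<close>

lemma rho_minus_one_in_pi_stabilizer:
  assumes "is_square (- 1 :: 'a::{field,finite})"
  shows "rho (- mat 1) \<in> (pi_stabilizer :: ('a ^ 2 ^ 2 \<Rightarrow> 'a ^ 2 ^ 2) set)"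
proof -
  obtain i :: 'a where i: "i ^ 2 = - 1" using assms by (auto simp: is_square_def)
  then have "i \<noteq> 0" by auto
  have "- x = i * (i * x)" for x using i by (simp add: power2_eq_square flip: mult.assoc)
  then have sq: "is_square (- x) \<longleftrightarrow> is_square x" for x :: 'a
    using is_square_mult_sq[OF \<open>i \<noteq> 0\<close>] by metis
  have "act_on_parallelism (rho (- mat 1)) (pi_odd :: ('a ^ 2 ^ 2) set set set) = pi_odd"
    by (rule act_pi_odd_of_isometry[of _ uminus "\<lambda>v. v"])
      (simp_all add: rho_in_PermSL2 rho_minus_one_vec uminus_mult_vec sq)
  then show ?thesis by (simp add: pi_stabilizer_iff auto_trans_incl)
qed

text \<open>Conjugation by \<open>c\<close> multiplies areas by \<open>1 / det c = - 1\<close>, and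
  the translation changes the sign of the source vector; the two signs cancel.\<close>

lemma gamma_rho_in_pi_stabilizer:
  fixes c :: "'a::{field,finite} ^ 2 ^ 2"
  assumes c: "det c = - 1"
  shows "gamma c \<otimes>\<^bsub>PermSL2\<^esub> rho (- mat 1) \<in> pi_stabilizer"
proof -
  have det: "det c \<noteq> 0" using c by simp
  let ?\<sigma> = "gamma c \<otimes>\<^bsub>PermSL2\<^esub> rho (- mat 1)"
  have \<gamma>: "gamma c \<in> auto SL2" by (rule gamma_auto[OF det])
  have \<sigma>: "?\<sigma> \<in> auto_trans"
    by (rule subgroup.m_closed[OF subgroup_auto_trans]) (simp_all add: auto_trans_incl \<gamma>)
  have "act_on_parallelism ?\<sigma> pi_odd = pi_odd"
  proof (rule act_pi_odd_of_isometry[of _ "\<lambda>v. - (matrix_inv c *v v)" "\<lambda>v. matrix_inv c *v v"])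
    show "?\<sigma> g *v - (matrix_inv c *v v) = matrix_inv c *v (g *v v)" if g: "g \<in> carrier SL2" for g v
      using g by (simp add: rho_minus_one_vec SL2_auto_closed[OF \<gamma>] uminus_mult_vec gamma_vec[OF det])
  qed (simp_all add: auto_trans_in_PermSL2[OF \<sigma>] matrix_inv_vec_eq_0_iff[OF det] area_mult SL2_conj[OF det] c)
  then show ?thesis using \<sigma> by (simp add: pi_stabilizer_iff)
qed

theorem mainTheorem2:
  fixes p e q :: nat
    and c :: "'a::{field,finite} ^ 2 ^ 2"
    and St :: "('a ^ 2 ^ 2 \<Rightarrow> 'a ^ 2 ^ 2) set"
  assumes "prime p" and "e \<ge> 1" and "q = p ^ e" and "odd q" and "CARD('a) = q"
    and "c = vector [vector [1, 0], vector [0, - 1]]"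
    and "St = stabilizer (PermSL2\<lparr>carrier := auto_trans\<rparr>) act_on_parallelism pi_odd"
  shows "parallelism p (pi_odd :: ('a ^ 2 ^ 2) set set set) \<and>
    (q mod 4 = 1 \<longrightarrow>
       internal_direct_product PermSL2 St PSigmaL2 (generate PermSL2 {rho (- mat 1)})) \<and>
    (q mod 4 = 3 \<longrightarrow>
       internal_semidirect_product PermSL2 St PSigmaL2
         (generate PermSL2 {gamma c \<otimes>\<^bsub>PermSL2\<^esub> rho (- mat 1)}))"
proof (intro conjI impI)
  have p: "prime p" "e \<ge> 1" "CARD('a) = p ^ e" and odd: "odd CARD('a)" using assms by simp_all
  have St: "St = pi_stabilizer" using assms by (simp add: pi_stabilizer_def)
  interpret P: group "PermSL2 :: ('a ^ 2 ^ 2 \<Rightarrow> 'a ^ 2 ^ 2) monoid" by (rule group_PermSL2)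
  show "parallelism p (pi_odd :: ('a ^ 2 ^ 2) set set set)" by (rule parallelism_pi_odd[OF p])
  let ?\<rho> = "rho (- mat 1) :: 'a ^ 2 ^ 2 \<Rightarrow> 'a ^ 2 ^ 2"
  have \<rho>P: "?\<rho> \<in> carrier PermSL2" by (simp add: rho_in_PermSL2)
  have \<rho>_sq: "?\<rho> \<otimes>\<^bsub>PermSL2\<^esub> ?\<rho> = \<one>\<^bsub>PermSL2\<^esub>"
    by (rule PermSL2_ext) (simp_all add: \<rho>P rho_minus_one_vec)
  {
    assume "q mod 4 = 1"
    then have \<rho>S: "?\<rho> \<in> pi_stabilizer"
      using assms by (intro rho_minus_one_in_pi_stabilizer minus_one_square) simp
    have "?\<rho> (mat 1) = - mat 1" by (simp add: rho_minus_one_vec)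
    then have semi: "internal_semidirect_product PermSL2 pi_stabilizer PSigmaL2 (generate PermSL2 {?\<rho>})"
      by (rule internal_semidirect_product_involution[OF p odd \<rho>S _ \<rho>_sq])
    have gen: "generate PermSL2 {?\<rho>} = {\<one>\<^bsub>PermSL2\<^esub>, ?\<rho>}" by (rule P.generate_involution[OF \<rho>P \<rho>_sq])
    have "generate PermSL2 {?\<rho>} \<lhd> PermSL2\<lparr>carrier := pi_stabilizer\<rparr>"
    proof (rule group.normal_invI[OF P.subgroup_imp_group[OF subgroup_pi_stabilizer]])
      show "subgroup (generate PermSL2 {?\<rho>}) (PermSL2\<lparr>carrier := pi_stabilizer\<rparr>)"
        using semi by (simp add: internal_semidirect_product_def)
      fix x n :: "'a ^ 2 ^ 2 \<Rightarrow> 'a ^ 2 ^ 2"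
      assume x: "x \<in> carrier (PermSL2\<lparr>carrier := pi_stabilizer\<rparr>)" and n: "n \<in> generate PermSL2 {?\<rho>}"
      then have xS: "x \<in> pi_stabilizer" and xP: "x \<in> carrier PermSL2" and xA: "x \<in> auto_trans"
        by (simp_all add: pi_stabilizer_in_PermSL2) (simp add: pi_stabilizer_iff)
      have nP: "n \<in> carrier PermSL2" using n \<rho>P by (auto simp: gen)
      \<comment> \<open>\<open>?\<rho>\<close> is negation of matrices, which commutes with all of
        \<open>auto_trans\<close>.\<close>
      have "x \<otimes>\<^bsub>PermSL2\<^esub> ?\<rho> = ?\<rho> \<otimes>\<^bsub>PermSL2\<^esub> x"
        by (rule PermSL2_ext)
          (simp_all add: xP \<rho>P rho_minus_one_vec PermSL2_closed[OF xP] auto_trans_uminus[OF p xA])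
      then have "x \<otimes>\<^bsub>PermSL2\<^esub> n = n \<otimes>\<^bsub>PermSL2\<^esub> x" using n xP by (auto simp: gen)
      then have "x \<otimes>\<^bsub>PermSL2\<^esub> n \<otimes>\<^bsub>PermSL2\<^esub> inv\<^bsub>PermSL2\<^esub> x = n" using xP nP by (simp add: P.m_assoc)
      then show "x \<otimes>\<^bsub>PermSL2\<lparr>carrier := pi_stabilizer\<rparr>\<^esub> n \<otimes>\<^bsub>PermSL2\<lparr>carrier := pi_stabilizer\<rparr>\<^esub>
          inv\<^bsub>PermSL2\<lparr>carrier := pi_stabilizer\<rparr>\<^esub> x \<in> generate PermSL2 {?\<rho>}"
        using P.m_inv_consistent[OF subgroup_pi_stabilizer xS] n by simp
    qed
    then show "internal_direct_product PermSL2 St PSigmaL2 (generate PermSL2 {?\<rho>})"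
      using semi by (simp add: internal_direct_product_def St)
  }
  have c: "c = M2 1 0 0 (- 1)" using assms(6) by (simp add: M2_def)
  then have det: "det c = - 1" "det c \<noteq> 0" by (simp_all add: det_M2)
  have cc: "c ** c = mat 1" by (simp add: c M2_mult mat_1_M2)
  have inv_c: "matrix_inv c = c"
  proof -
    have "matrix_inv c ** c ** c = c" by (simp add: SL2_conj[OF det(2)])
    then show ?thesis by (simp add: cc flip: matrix_mul_assoc)
  qed
  let ?k = "gamma c \<otimes>\<^bsub>PermSL2\<^esub> ?\<rho>"
  have kS: "?k \<in> pi_stabilizer" by (rule gamma_rho_in_pi_stabilizer[OF det(1)])
  have k_apply: "?k g = - (c ** g ** c)" "?k g \<in> carrier SL2" if g: "g \<in> carrier SL2" for g
  proof -
    have "gamma c g \<in> carrier SL2" by (rule SL2_auto_closed[OF gamma_auto[OF det(2)] g])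
    then show "?k g = - (c ** g ** c)" using g by (simp add: rho_minus_one_vec) (simp add: gamma_def inv_c)
    show "?k g \<in> carrier SL2" by (rule PermSL2_closed[OF pi_stabilizer_in_PermSL2[OF kS] g])
  qed
  have "?k \<otimes>\<^bsub>PermSL2\<^esub> ?k = \<one>\<^bsub>PermSL2\<^esub>"
  proof (rule PermSL2_ext)
    show "?k \<otimes>\<^bsub>PermSL2\<^esub> ?k \<in> carrier PermSL2" using pi_stabilizer_in_PermSL2[OF kS] by simp
    fix g :: "'a ^ 2 ^ 2" assume g: "g \<in> carrier SL2"
    \<comment> \<open>Applying \<open>?k\<close> twice negates twice and conjugates by
      \<open>c\<close> twice, and \<open>c\<close> is its own inverse.\<close>
    have "c ** (c ** g ** c) ** c = (c ** c) ** g ** (c ** c)" by (simp add: matrix_mul_assoc)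
    then have "c ** (c ** g ** c) ** c = g" by (simp add: cc)
    then have "?k (?k g) = g"
      unfolding k_apply(1)[OF k_apply(2)[OF g]] unfolding k_apply(1)[OF g] by (simp add: uminus_matrix_mult)
    then show "(?k \<otimes>\<^bsub>PermSL2\<^esub> ?k) g = \<one>\<^bsub>PermSL2\<^esub> g" using g by (simp del: mult_PermSL2_apply add: mult_PermSL2_apply[of g ?k])
  qed simp
  moreover have "?k (mat 1) = - mat 1" by (subst k_apply(1)) (simp_all add: cc)
  ultimately show "internal_semidirect_product PermSL2 St PSigmaL2 (generate PermSL2 {?k})"
    unfolding St by (intro internal_semidirect_product_involution[OF p odd kS])
qed

end
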